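(* The image $\operatorname{Im}(G)=\{([\alpha,t]_\Bbbk,\widehat T_\alpha^t(f)) : c\preceq\alpha\preceq t\preceq d,\ f\in\widehat{\mathbf S_\tau(\mathbb I_\Lambda)}\}$ of the map $G$ is a left $\Lambda$-submodule of $\operatorname{Im}(+)$.
   Context: Setting. $\Bbbk$ is a complete field containing $\mathbb R$, with a norm $|\cdot|:\Bbbk\to\mathbb R^{\ge0}$ ($|k|=0$ iff $k=0$; $|k_1k_2|=|k_1||k_2|$; triangle inequality). $\Lambda$ is a finite-dimensional $\Bbbk$-algebra with basis $b_1,\dots,b_n$, $\tau:\Lambda\to\Bbbk$ is a fixed homomorphism of $\Bbbk$-algebras, and $p\ge1$. $\mathbb I=[c,d]_\Bbbk\subseteq\Bbbk$ is a totally ordered subset (order $\preceq$) with minimum $c$ and maximum $d$; $[s,t]_\Bbbk=\{x\in\mathbb I: s\preceq x\preceq t\}$. Segmentation condition: for each $[s,t]_\Bbbk$ with $s\prec t$ there are $\xi'$ with $s\prec\xi'\prec t$ and order-preserving bijections $\kappa_s:[s,t]_\Bbbk\to[s,\xi']_\Bbbk$, $\kappa_t:[s,t]_\Bbbk\to[\xi',t]_\Bbbk$; these are fixed. Put $[s,t]_\Lambda=\sum_i[s,t]_\Bbbk b_i\subseteq\Lambda$ and $\mathbb I_\Lambda=[c,d]_\Lambda$. $\mu_{\mathbb I}$ is a measure on the $\sigma$-algebra generated by the subintervals of $\mathbb I$, zero on points; $\Sigma(\mathbb I_\Lambda)$ is the $\sigma$-algebra generated by the sets $\sum_i I_ib_i$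 ($I_i$ subintervals of $\mathbb I$), and $\mu$ is the induced measure, $\mu(\sum_iI_ib_i)=\prod_i\mu_{\mathbb I}(I_i)$. The interval $[s,t]_\Bbbk$ is identified with $[s,t]_\Lambda\in\Sigma(\mathbb I_\Lambda)$. Function modules. For $J=[s,t]_\Bbbk$, $\mathbf S_\tau(J_\Lambda)$ is the set of classes, modulo equality $\mu$-a.e., of finite sums $\sum_ik_i\mathbf 1_{X_i}$ ($k_i\in\Bbbk$, the $X_i$ being pairwise disjoint products of intervals covering $J_\Lambda$), with norm $(\sum_i|k_i|^p\mu(X_i)^p)^{1/p}$ and $\Lambda$-action $a\cdot f=\tau(a)f$; $\widehat{\mathbf S_\tau(J_\Lambda)}$ is its completion. Functions on $\mathbb I_\Lambda$ are restricted to $J_\Lambda$ when needed. Category and integral. A Banach $\Lambda$-module is a left $\Lambda$-module with a complete norm such that $\|am\|=|\tau(a)|\|m\|$. The category $\mathscr A^p$ attached to $J$ has objects $(N,v,\delta)$: $N$ a Banach $\Lambda$-module, $v\in N$ with $\|v\|\le\mu(J_\Lambda)$, and $\delta:N^{\oplus_p2^n}\to N$ a $\Lambda$-homomorphism with $\delta(v,\dots,v)=v$ commuting with limits of monotone decreasing Cauchy sequences, where $N^{\oplus_p2^n}$ has norm $((\mu_{\mathbb I}(J)/\mu(J_\Lambda))^n\sum_i\|x_i\|^p)^{1/p}$. Morphisms $(N,v,\delta)\to(N',v',\delta')$ are $\Lambda$-homomorphisms $\theta$ with $\theta(v)=v'$, $\theta\delta=\delta'\theta^{\oplus2^n}$.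 It is known that $(\widehat{\mathbf S_\tau(J_\Lambda)},\mathbf 1,\widehat\gamma)$ is an initial object, $\gamma$ being the juxtaposition map $\gamma(\mathbf f)(k_1,\dots,k_n)=\sum_{(\delta_i)\in\{s,t\}^n}\mathbf 1_{\prod\kappa_{\delta_i}(J)}f_{\delta_1,\dots,\delta_n}(\kappa_{\delta_1}^{-1}(k_1),\dots,\kappa_{\delta_n}^{-1}(k_n))$. $\widehat T_s^t:\widehat{\mathbf S_\tau(J_\Lambda)}\to\Bbbk$ is the unique morphism to the object $(\Bbbk,\mu(J_\Lambda),m)$, where $\Lambda$ acts on $\Bbbk$ via $\tau$ and $m:\Bbbk^{\oplus2^n}\to\Bbbk$ is the fixed $\Lambda$-homomorphism for which $\widehat T_s^t$ is integration against $\mu$, i.e. $\widehat T_s^t(\mathbf 1_X)=\mu(X)$; also written $\widehat T_s^t(f)=(\mathscr A^p)\int_{[s,t]_\Lambda}f\,d\mu$. For $s=t$ it is $0$. Addition. Let $\mathcal T$ be the collection of all pairs $([s,t]_\Bbbk,\widehat T_s^t(f))$ with $c\preceq s\preceq t\preceq d$ and $f\in\widehat{\mathbf S_\tau(\mathbb I_\Lambda)}$ (a disjoint union over $f$). The map $+:\mathcal T\times\mathcal T\to\Sigma(\mathbb I_\Lambda)\times\Bbbk$ is $$([u,v]_\Bbbk,\widehat T_u^v(f))+([s,t]_\Bbbk,\widehat T_s^t(g)):=\big([y_1,y_2]_\Bbbk,\ \widehat T_{y_1}^{y_2}(\mathbf 1_{[u,v]_\Lambda}f+\mathbf 1_{[s,t]_\Lambda}g)\big),$$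 $y_1=\min\{u,v,s,t\}$, $y_2=\max\{u,v,s,t\}$. $\operatorname{Im}(+)$ denotes its image; its elements are again pairs of the form $([y_1,y_2]_\Bbbk,\widehat T_{y_1}^{y_2}(h))$, and $\operatorname{Im}(+)$ carries this same addition, the scalar action $k\cdot(S,r)=(S,kr)$ ($k\in\Bbbk$) and the left $\Lambda$-action $a\star(S,r)=(S,\tau(a)r)$, with which it is regarded as a left $\Lambda$-module. The map $G$. For $\alpha\in\mathbb I$ and $f\in\widehat{\mathbf S_\tau(\mathbb I_\Lambda)}$ let $\mathfrak S_{\alpha,f}=\{(t,(\mathscr A^p)\int_{[\alpha,t]_\Lambda}f\,d\mu)\in\Bbbk\times\Bbbk:\alpha\preceq t\preceq d\}$ and let $\mathfrak S$ be the union of all $\mathfrak S_{\alpha,f}$ (the index $\alpha$ being remembered). $G:\mathfrak S\to\Sigma(\mathbb I_\Lambda)\times\Bbbk$ sends $(t,(\mathscr A^p)\int_{[\alpha,t]_\Lambda}f\,d\mu)\in\mathfrak S_{\alpha,f}$ to $([\alpha,t]_\Bbbk,\widehat T_\alpha^t(f))$.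
   Formalization: Im(+) has no global zero unless c=d, so "left Λ-submodule" means nonempty, closed under +, k and Λ, inside Im(+) satisfying all module laws not mentioning zero; the norm, ill-defined for p>1, is the infimum over representations, and morphisms are taken continuous. *)

theory Defs
  imports "HOL-Analysis.Analysis" "HOL-Algebra.Module"
begin

section \<open>The fixed data\<close>

text \<open>
  The type \<open>'k\<close> is a field containing the reals (via \<^const>\<open>of_real\<close>), \<open>'l\<close> is the underlying ring of
  the algebra, and the basis is indexed by the finite type \<open>'n\<close>, so \<open>n = CARD('n)\<close>.
  The absolute value is an explicit function, because it is not
  required to restrict to the usual absolute value on the reals.
  For \<open>s \<prec> t\<close>, \<open>mid s t\<close> is \<open>\<xi>'\<close>, and \<open>kap s t False\<close>, \<open>kap s t True\<close> are \<open>\<kappa>\<^sub>s\<close>, \<open>\<kappa>\<^sub>t\<close>;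
  \<open>mfix s t\<close> is the map \<open>m\<close> belonging to \<open>[s,t]\<close>. Families indexed by \<open>{s,t}\<^sup>n\<close> are functions on
  \<open>'n \<Rightarrow> bool\<close>.
\<close>

record ('k, 'l, 'n) integration_data =
  absv :: "'k \<Rightarrow> real"
  scal :: "'k \<Rightarrow> 'l \<Rightarrow> 'l"
  tau :: "'l \<Rightarrow> 'k"
  bas :: "'n \<Rightarrow> 'l"
  pex :: real
  II :: "'k set"
  ordI :: "('k \<times> 'k) set"
  cmin :: 'k
  dmax :: 'k
  mid :: "'k \<Rightarrow> 'k \<Rightarrow> 'k"
  kap :: "'k \<Rightarrow> 'k \<Rightarrow> bool \<Rightarrow> 'k \<Rightarrow> 'k"
  muI :: "'k measure"
  mu :: "'l measure"
  mfix :: "'k \<Rightarrow> 'k \<Rightarrow> (('n \<Rightarrow> bool) \<Rightarrow> 'k) \<Rightarrow> 'k"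

definition leI :: "('k, 'l, 'n) integration_data \<Rightarrow> 'k \<Rightarrow> 'k \<Rightarrow> bool" where
  "leI D x y \<longleftrightarrow> (x, y) \<in> ordI D"

definition ltI :: "('k, 'l, 'n) integration_data \<Rightarrow> 'k \<Rightarrow> 'k \<Rightarrow> bool" where
  "ltI D x y \<longleftrightarrow> leI D x y \<and> x \<noteq> y"

definition omin :: "('k, 'l, 'n) integration_data \<Rightarrow> 'k set \<Rightarrow> 'k" where
  "omin D A = (THE x. x \<in> A \<and> (\<forall>y\<in>A. leI D x y))"

definition omax :: "('k, 'l, 'n) integration_data \<Rightarrow> 'k set \<Rightarrow> 'k" where
  "omax D A = (THE x. x \<in> A \<and> (\<forall>y\<in>A. leI D y x))"

definition seg :: "('k, 'l, 'n) integration_data \<Rightarrow> 'k \<Rightarrow> 'k \<Rightarrow> 'k set" where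
  "seg D s t = {x \<in> II D. leI D s x \<and> leI D x t}"

definition subintervals :: "('k, 'l, 'n) integration_data \<Rightarrow> 'k set set" where
  "subintervals D = (\<Union>u\<in>II D. \<Union>v\<in>II D.
     {seg D u v, seg D u v - {u}, seg D u v - {v}, seg D u v - {u, v}})"

definition comb :: "('k, 'l::ring_1, 'n::finite) integration_data \<Rightarrow> ('n \<Rightarrow> 'k) \<Rightarrow> 'l" where
  "comb D x = (\<Sum>i\<in>UNIV. scal D (x i) (bas D i))"

definition coord :: "('k, 'l::ring_1, 'n::finite) integration_data \<Rightarrow> 'l \<Rightarrow> 'n \<Rightarrow> 'k" where
  "coord D = inv_into UNIV (comb D)"

definition boxL :: "('k, 'l::ring_1, 'n::finite) integration_data \<Rightarrow> ('n \<Rightarrow> 'k set) \<Rightarrow> 'l set" where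
  "boxL D B = comb D ` {x. \<forall>i. x i \<in> B i}"

definition boxes :: "('k, 'l::ring_1, 'n::finite) integration_data \<Rightarrow> 'l set set" where
  "boxes D = {boxL D B | B. \<forall>i. B i \<in> subintervals D}"

definition segL :: "('k, 'l::ring_1, 'n::finite) integration_data \<Rightarrow> 'k \<Rightarrow> 'k \<Rightarrow> 'l set" where
  "segL D s t = boxL D (\<lambda>_. seg D s t)"

definition SigmaL :: "('k, 'l::ring_1, 'n::finite) integration_data \<Rightarrow> 'l set set" where
  "SigmaL D = sigma_sets (segL D (cmin D) (dmax D)) (boxes D)"

text \<open>The measure \<open>\<mu>\<close> on \<open>\<Sigma>(\<I>\<^sub>\<Lambda>)\<close> is pinned down by its values on boxes. The measure on \<open>\<I>\<close> is finite,
  since measures of boxes have to be elements of \<open>'k\<close>.\<close>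

definition basic_setting :: "('k::real_field, 'l::ring_1, 'n::finite) integration_data \<Rightarrow> bool" where
  "basic_setting D \<longleftrightarrow>
    (\<forall>k. 0 \<le> absv D k) \<and> (\<forall>k. absv D k = 0 \<longleftrightarrow> k = 0) \<and>
    (\<forall>k l. absv D (k * l) = absv D k * absv D l) \<and>
    (\<forall>k l. absv D (k + l) \<le> absv D k + absv D l) \<and>
    (\<forall>X :: nat \<Rightarrow> 'k. (\<forall>e>0. \<exists>M. \<forall>i\<ge>M. \<forall>j\<ge>M. absv D (X i - X j) < e) \<longrightarrow>
       (\<exists>x. (\<lambda>i. absv D (X i - x)) \<longlonglongrightarrow> 0)) \<and>
    finite_dimensional_vector_space (scal D) (range (bas D)) \<and> inj (bas D) \<and>
    (\<forall>k x y. scal D k x * y = scal D k (x * y) \<and> x * scal D k y = scal D k (x * y)) \<and>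
    (\<forall>x y. tau D (x + y) = tau D x + tau D y) \<and>
    (\<forall>x y. tau D (x * y) = tau D x * tau D y) \<and>
    tau D 1 = 1 \<and> (\<forall>k x. tau D (scal D k x) = k * tau D x) \<and>
    1 \<le> pex D \<and>
    linear_order_on (II D) (ordI D) \<and>
    cmin D \<in> II D \<and> dmax D \<in> II D \<and>
    (\<forall>x\<in>II D. leI D (cmin D) x \<and> leI D x (dmax D)) \<and>
    (\<forall>s\<in>II D. \<forall>t\<in>II D. ltI D s t \<longrightarrow>
       ltI D s (mid D s t) \<and> ltI D (mid D s t) t \<and>
       bij_betw (kap D s t False) (seg D s t) (seg D s (mid D s t)) \<and>
       bij_betw (kap D s t True) (seg D s t) (seg D (mid D s t) t) \<and>
       (\<forall>e. \<forall>x\<in>seg D s t. \<forall>y\<in>seg D s t. leI D x y \<longrightarrow> leI D (kap D s t e x) (kap D s t e y))) \<and>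
    space (muI D) = II D \<and> sets (muI D) = sigma_sets (II D) (subintervals D) \<and>
    finite_measure (muI D) \<and> (\<forall>x\<in>II D. emeasure (muI D) {x} = 0) \<and>
    space (mu D) = segL D (cmin D) (dmax D) \<and> sets (mu D) = SigmaL D \<and>
    (\<forall>B. (\<forall>i. B i \<in> subintervals D) \<longrightarrow>
       emeasure (mu D) (boxL D B) = (\<Prod>i\<in>UNIV. emeasure (muI D) (B i)))"

section \<open>Step functions and their completion\<close>

definition step_rep :: "('k::real_field, 'l::ring_1, 'n::finite) integration_data \<Rightarrow> 'k \<Rightarrow> 'k \<Rightarrow>
    'l set set \<Rightarrow> ('l set \<Rightarrow> 'k) \<Rightarrow> ('l \<Rightarrow> 'k) \<Rightarrow> bool" where
  "step_rep D s t P k f \<longleftrightarrow> finite P \<and> P \<subseteq> boxes D \<and> partition_on (segL D s t) P \<and>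
     f = (\<lambda>x. \<Sum>X\<in>P. k X * indicator X x)"

definition step :: "('k::real_field, 'l::ring_1, 'n::finite) integration_data \<Rightarrow> 'k \<Rightarrow> 'k \<Rightarrow>
    ('l \<Rightarrow> 'k) set" where
  "step D s t = {f. \<exists>P k. step_rep D s t P k f}"

text \<open>
  The formula \<open>(\<Sum>\<^sub>i |k\<^sub>i|\<^sup>p \<mu>(X\<^sub>i)\<^sup>p)\<^bsup>1/p\<^esup>\<close> refers to a representation of the step function. For \<open>p = 1\<close> it
  does not depend on the representation; for \<open>p > 1\<close> it can only decrease when the representation is
  refined. The infimum over all representations is a seminorm for every \<open>p \<ge> 1\<close>, and is the value
  of the formula whenever that is independent of the representation.
\<close>

definition step_norm :: "('k::real_field, 'l::ring_1, 'n::finite) integration_data \<Rightarrow> 'k \<Rightarrow> 'k \<Rightarrow>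
    ('l \<Rightarrow> 'k) \<Rightarrow> real" where
  "step_norm D s t f = Inf {(\<Sum>X\<in>P. absv D (k X) powr pex D * measure (mu D) X powr pex D) powr (1 / pex D)
     | P k. step_rep D s t P k f}"

text \<open>
  Elements of the completion are equivalence classes of Cauchy sequences of step functions, two
  sequences being equivalent if the norm of their difference tends to \<open>0\<close>. A step function that
  vanishes \<open>\<mu>\<close>-a.e. has norm \<open>0\<close>, so this quotient also identifies functions that are equal \<open>\<mu>\<close>-a.e.
\<close>

type_synonym ('k, 'l) completed = "(nat \<Rightarrow> 'l \<Rightarrow> 'k) set"

definition step_Cauchy :: "('k::real_field, 'l::ring_1, 'n::finite) integration_data \<Rightarrow> 'k \<Rightarrow> 'k \<Rightarrow>
    (nat \<Rightarrow> 'l \<Rightarrow> 'k) set" where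
  "step_Cauchy D s t = {F. (\<forall>i. F i \<in> step D s t) \<and>
     (\<forall>e>0. \<exists>M. \<forall>i\<ge>M. \<forall>j\<ge>M. step_norm D s t (\<lambda>x. F i x - F j x) < e)}"

definition compl_rel :: "('k::real_field, 'l::ring_1, 'n::finite) integration_data \<Rightarrow> 'k \<Rightarrow> 'k \<Rightarrow>
    ((nat \<Rightarrow> 'l \<Rightarrow> 'k) \<times> (nat \<Rightarrow> 'l \<Rightarrow> 'k)) set" where
  "compl_rel D s t = {(F, G). F \<in> step_Cauchy D s t \<and> G \<in> step_Cauchy D s t \<and>
     (\<lambda>i. step_norm D s t (\<lambda>x. F i x - G i x)) \<longlonglongrightarrow> 0}"

definition Shat :: "('k::real_field, 'l::ring_1, 'n::finite) integration_data \<Rightarrow> 'k \<Rightarrow> 'k \<Rightarrow>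
    ('k, 'l) completed set" where
  "Shat D s t = step_Cauchy D s t // compl_rel D s t"

definition step_class :: "('k::real_field, 'l::ring_1, 'n::finite) integration_data \<Rightarrow> 'k \<Rightarrow> 'k \<Rightarrow>
    ('l \<Rightarrow> 'k) \<Rightarrow> ('k, 'l) completed" where
  "step_class D s t f = compl_rel D s t `` {\<lambda>_. f}"

text \<open>The map into the completion over \<open>[s,t]\<close> induced by a map \<open>\<phi>\<close> of step functions.\<close>

definition compl_lift :: "('k::real_field, 'l::ring_1, 'n::finite) integration_data \<Rightarrow> 'k \<Rightarrow> 'k \<Rightarrow>
    (('l \<Rightarrow> 'k) \<Rightarrow> ('l \<Rightarrow> 'k)) \<Rightarrow> ('k, 'l) completed \<Rightarrow> ('k, 'l) completed" where
  "compl_lift D s t \<phi> A = (\<Union>F\<in>A. compl_rel D s t `` {\<lambda>i. \<phi> (F i)})"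

definition compl_add :: "('k::real_field, 'l::ring_1, 'n::finite) integration_data \<Rightarrow> 'k \<Rightarrow> 'k \<Rightarrow>
    ('k, 'l) completed \<Rightarrow> ('k, 'l) completed \<Rightarrow> ('k, 'l) completed" where
  "compl_add D s t A B = (\<Union>F\<in>A. \<Union>G\<in>B. compl_rel D s t `` {\<lambda>i x. F i x + G i x})"

definition compl_norm :: "('k::real_field, 'l::ring_1, 'n::finite) integration_data \<Rightarrow> 'k \<Rightarrow> 'k \<Rightarrow>
    ('k, 'l) completed \<Rightarrow> real" where
  "compl_norm D s t A = (THE r. \<forall>F\<in>A. (\<lambda>i. step_norm D s t (F i)) \<longlonglongrightarrow> r)"

definition times_ind :: "'l set \<Rightarrow> ('l \<Rightarrow> 'k::real_field) \<Rightarrow> 'l \<Rightarrow> 'k" where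
  "times_ind X f = (\<lambda>x. indicator X x * f x)"

definition restr :: "('k::real_field, 'l::ring_1, 'n::finite) integration_data \<Rightarrow> 'k \<Rightarrow> 'k \<Rightarrow>
    ('k, 'l) completed \<Rightarrow> ('k, 'l) completed" where
  "restr D s t = compl_lift D s t (times_ind (segL D s t))"

definition juxt :: "('k::real_field, 'l::ring_1, 'n::finite) integration_data \<Rightarrow> 'k \<Rightarrow> 'k \<Rightarrow>
    (('n \<Rightarrow> bool) \<Rightarrow> 'l \<Rightarrow> 'k) \<Rightarrow> 'l \<Rightarrow> 'k" where
  "juxt D s t f x = (\<Sum>\<epsilon>\<in>UNIV. indicator (boxL D (\<lambda>i. kap D s t (\<epsilon> i) ` seg D s t)) x *
     f \<epsilon> (comb D (\<lambda>i. inv_into (seg D s t) (kap D s t (\<epsilon> i)) (coord D x i))))"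

definition juxt_hat :: "('k::real_field, 'l::ring_1, 'n::finite) integration_data \<Rightarrow> 'k \<Rightarrow> 'k \<Rightarrow>
    (('n \<Rightarrow> bool) \<Rightarrow> ('k, 'l) completed) \<Rightarrow> ('k, 'l) completed" where
  "juxt_hat D s t A = (\<Union>F\<in>{F. \<forall>\<epsilon>. F \<epsilon> \<in> A \<epsilon>}. compl_rel D s t `` {\<lambda>i. juxt D s t (\<lambda>\<epsilon>. F \<epsilon> i)})"

section \<open>Banach modules and the category of an interval\<close>

text \<open>The fields \<open>mult\<close> and \<open>one\<close> inherited from \<^type>\<open>module\<close> play no role; the locale
  \<^locale>\<open>module\<close> itself is unsuitable because the scalars are not commutative.\<close>

record ('a, 'm) normed_module = "('a, 'm) module" +
  mnorm :: "'m \<Rightarrow> real"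

definition converges_in :: "('l, 'm) normed_module \<Rightarrow> (nat \<Rightarrow> 'm) \<Rightarrow> 'm \<Rightarrow> bool" where
  "converges_in M X x \<longleftrightarrow> (\<forall>i. X i \<in> carrier M) \<and> x \<in> carrier M \<and>
     (\<lambda>i. mnorm M (X i \<ominus>\<^bsub>M\<^esub> x)) \<longlonglongrightarrow> 0"

definition Cauchy_in :: "('l, 'm) normed_module \<Rightarrow> (nat \<Rightarrow> 'm) \<Rightarrow> bool" where
  "Cauchy_in M X \<longleftrightarrow> (\<forall>i. X i \<in> carrier M) \<and>
     (\<forall>e>0. \<exists>K. \<forall>i\<ge>K. \<forall>j\<ge>K. mnorm M (X i \<ominus>\<^bsub>M\<^esub> X j) < e)"

definition banach_module :: "('k::real_field, 'l::ring_1, 'n::finite) integration_data \<Rightarrow>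
    ('l, 'm) normed_module \<Rightarrow> bool" where
  "banach_module D M \<longleftrightarrow> abelian_group M \<and>
     (\<forall>a. \<forall>x\<in>carrier M. a \<odot>\<^bsub>M\<^esub> x \<in> carrier M) \<and>
     (\<forall>a b. \<forall>x\<in>carrier M. (a + b) \<odot>\<^bsub>M\<^esub> x = a \<odot>\<^bsub>M\<^esub> x \<oplus>\<^bsub>M\<^esub> b \<odot>\<^bsub>M\<^esub> x) \<and>
     (\<forall>a. \<forall>x\<in>carrier M. \<forall>y\<in>carrier M. a \<odot>\<^bsub>M\<^esub> (x \<oplus>\<^bsub>M\<^esub> y) = a \<odot>\<^bsub>M\<^esub> x \<oplus>\<^bsub>M\<^esub> a \<odot>\<^bsub>M\<^esub> y) \<and>
     (\<forall>a b. \<forall>x\<in>carrier M. (a * b) \<odot>\<^bsub>M\<^esub> x = a \<odot>\<^bsub>M\<^esub> (b \<odot>\<^bsub>M\<^esub> x)) \<and>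
     (\<forall>x\<in>carrier M. 1 \<odot>\<^bsub>M\<^esub> x = x) \<and>
     (\<forall>x\<in>carrier M. 0 \<le> mnorm M x \<and> (mnorm M x = 0 \<longleftrightarrow> x = \<zero>\<^bsub>M\<^esub>)) \<and>
     (\<forall>x\<in>carrier M. \<forall>y\<in>carrier M. mnorm M (x \<oplus>\<^bsub>M\<^esub> y) \<le> mnorm M x + mnorm M y) \<and>
     (\<forall>a. \<forall>x\<in>carrier M. mnorm M (a \<odot>\<^bsub>M\<^esub> x) = absv D (tau D a) * mnorm M x) \<and>
     (\<forall>X. Cauchy_in M X \<longrightarrow> (\<exists>x. converges_in M X x))"

definition lambda_hom :: "('l, 'm) normed_module \<Rightarrow> ('l, 'm2) normed_module \<Rightarrow> ('m \<Rightarrow> 'm2) \<Rightarrow> bool" where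
  "lambda_hom M N h \<longleftrightarrow> h \<in> carrier M \<rightarrow> carrier N \<and>
     (\<forall>x\<in>carrier M. \<forall>y\<in>carrier M. h (x \<oplus>\<^bsub>M\<^esub> y) = h x \<oplus>\<^bsub>N\<^esub> h y) \<and>
     (\<forall>a. \<forall>x\<in>carrier M. h (a \<odot>\<^bsub>M\<^esub> x) = a \<odot>\<^bsub>N\<^esub> h x)"

text \<open>The module \<open>N\<^bsup>\<oplus>\<^sub>p 2\<^sup>n\<^esup>\<close> for the interval \<open>J = [s,t]\<close>.\<close>

definition dsum :: "('k::real_field, 'l::ring_1, 'n::finite) integration_data \<Rightarrow> 'k \<Rightarrow> 'k \<Rightarrow>
    ('l, 'm) normed_module \<Rightarrow> ('l, ('n \<Rightarrow> bool) \<Rightarrow> 'm) normed_module" where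
  "dsum D s t M = \<lparr>carrier = {x. \<forall>\<epsilon>. x \<epsilon> \<in> carrier M}, mult = undefined, one = undefined,
     zero = (\<lambda>_. \<zero>\<^bsub>M\<^esub>), add = (\<lambda>x y \<epsilon>. x \<epsilon> \<oplus>\<^bsub>M\<^esub> y \<epsilon>), smult = (\<lambda>a x \<epsilon>. a \<odot>\<^bsub>M\<^esub> x \<epsilon>),
     mnorm = (\<lambda>x. ((measure (muI D) (seg D s t) / measure (mu D) (segL D s t)) ^ CARD('n) *
       (\<Sum>\<epsilon>\<in>UNIV. mnorm M (x \<epsilon>) powr pex D)) powr (1 / pex D))\<rparr>"

text \<open>A sequence in a normed module is monotone decreasing if its norms are.\<close>

definition A_object :: "('k::real_field, 'l::ring_1, 'n::finite) integration_data \<Rightarrow> 'k \<Rightarrow> 'k \<Rightarrow>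
    ('l, 'm) normed_module \<times> 'm \<times> ((('n \<Rightarrow> bool) \<Rightarrow> 'm) \<Rightarrow> 'm) \<Rightarrow> bool" where
  "A_object D s t = (\<lambda>(M, v, \<delta>). banach_module D M \<and>
     v \<in> carrier M \<and> mnorm M v \<le> measure (mu D) (segL D s t) \<and>
     lambda_hom (dsum D s t M) M \<delta> \<and> \<delta> (\<lambda>_. v) = v \<and>
     (\<forall>X L. Cauchy_in (dsum D s t M) X \<longrightarrow>
        (\<forall>i. mnorm (dsum D s t M) (X (Suc i)) \<le> mnorm (dsum D s t M) (X i)) \<longrightarrow>
        converges_in (dsum D s t M) X L \<longrightarrow> converges_in M (\<lambda>i. \<delta> (X i)) (\<delta> L)))"

text \<open>Homomorphisms between Banach modules are continuous. Being extensional makes a morphism a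
  function on the carrier only, as needed for uniqueness.\<close>

definition A_morphism :: "('k::real_field, 'l::ring_1, 'n::finite) integration_data \<Rightarrow> 'k \<Rightarrow> 'k \<Rightarrow>
    ('l, 'm) normed_module \<times> 'm \<times> ((('n \<Rightarrow> bool) \<Rightarrow> 'm) \<Rightarrow> 'm) \<Rightarrow>
    ('l, 'm2) normed_module \<times> 'm2 \<times> ((('n \<Rightarrow> bool) \<Rightarrow> 'm2) \<Rightarrow> 'm2) \<Rightarrow> ('m \<Rightarrow> 'm2) \<Rightarrow> bool" where
  "A_morphism D s t = (\<lambda>(M, v, \<delta>) (M', v', \<delta>') \<theta>.
     \<theta> \<in> extensional (carrier M) \<and> lambda_hom M M' \<theta> \<and>
     (\<forall>X x. converges_in M X x \<longrightarrow> converges_in M' (\<lambda>i. \<theta> (X i)) (\<theta> x)) \<and>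
     \<theta> v = v' \<and> (\<forall>x\<in>carrier (dsum D s t M). \<theta> (\<delta> x) = \<delta>' (\<lambda>\<epsilon>. \<theta> (x \<epsilon>))))"

definition Shat_module :: "('k::real_field, 'l::ring_1, 'n::finite) integration_data \<Rightarrow> 'k \<Rightarrow> 'k \<Rightarrow>
    ('l, ('k, 'l) completed) normed_module" where
  "Shat_module D s t = \<lparr>carrier = Shat D s t, mult = undefined, one = undefined,
     zero = step_class D s t (\<lambda>_. 0), add = compl_add D s t,
     smult = (\<lambda>a. compl_lift D s t (\<lambda>f x. tau D a * f x)), mnorm = compl_norm D s t\<rparr>"

definition Shat_object :: "('k::real_field, 'l::ring_1, 'n::finite) integration_data \<Rightarrow> 'k \<Rightarrow> 'k \<Rightarrow>
    ('l, ('k, 'l) completed) normed_module \<times> ('k, 'l) completed \<times>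
    ((('n \<Rightarrow> bool) \<Rightarrow> ('k, 'l) completed) \<Rightarrow> ('k, 'l) completed)" where
  "Shat_object D s t = (Shat_module D s t, step_class D s t (indicator (segL D s t)), juxt_hat D s t)"

definition field_module :: "('k::real_field, 'l::ring_1, 'n::finite) integration_data \<Rightarrow>
    ('l, 'k) normed_module" where
  "field_module D = \<lparr>carrier = UNIV, mult = (*), one = 1, zero = 0, add = (+),
     smult = (\<lambda>a x. tau D a * x), mnorm = absv D\<rparr>"

definition field_object :: "('k::real_field, 'l::ring_1, 'n::finite) integration_data \<Rightarrow> 'k \<Rightarrow> 'k \<Rightarrow>
    ('l, 'k) normed_module \<times> 'k \<times> ((('n \<Rightarrow> bool) \<Rightarrow> 'k) \<Rightarrow> 'k)" where
  "field_object D s t = (field_module D, of_real (measure (mu D) (segL D s t)), mfix D s t)"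

definition That :: "('k::real_field, 'l::ring_1, 'n::finite) integration_data \<Rightarrow> 'k \<Rightarrow> 'k \<Rightarrow>
    ('k, 'l) completed \<Rightarrow> 'k" where
  "That D s t A = (if s = t then 0
     else (THE \<theta>. A_morphism D s t (Shat_object D s t) (field_object D s t) \<theta>) A)"

text \<open>
  The standing facts about the category: for every \<open>s \<prec> t\<close>, the function module and the field are
  objects, there is exactly one morphism from the former to the latter (the instance of
  initiality through which \<open>That\<close> is defined), and \<open>m\<close> is such that this morphism is integration
  against \<open>\<mu>\<close>.
\<close>

definition integration_setting :: "('k::real_field, 'l::ring_1, 'n::finite) integration_data \<Rightarrow> bool" where
  "integration_setting D \<longleftrightarrow> basic_setting D \<and>
    (\<forall>s\<in>II D. \<forall>t\<in>II D. ltI D s t \<longrightarrow>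
       A_object D s t (Shat_object D s t) \<and> A_object D s t (field_object D s t) \<and>
       (\<exists>!\<theta>. A_morphism D s t (Shat_object D s t) (field_object D s t) \<theta>) \<and>
       (\<forall>X\<in>boxes D. X \<subseteq> segL D s t \<longrightarrow>
          That D s t (step_class D s t (indicator X)) = of_real (measure (mu D) X)))"

section \<open>The images of addition and of \<open>G\<close>\<close>

definition Shat_I :: "('k::real_field, 'l::ring_1, 'n::finite) integration_data \<Rightarrow> ('k, 'l) completed set" where
  "Shat_I D = Shat D (cmin D) (dmax D)"

definition integral_over :: "('k::real_field, 'l::ring_1, 'n::finite) integration_data \<Rightarrow> 'k \<Rightarrow> 'k \<Rightarrow>
    ('k, 'l) completed \<Rightarrow> 'k" where
  "integral_over D s t f = That D s t (restr D s t f)"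

text \<open>An element of \<open>\<T>\<close> is a pair together with the \<open>f\<close> it comes from; it is encoded by \<open>(s, t, f)\<close>,
  and \<open>pair_of\<close> is the underlying pair, with \<open>[s,t]\<close> written as the member \<open>[s,t]\<^sub>\<Lambda>\<close> of \<open>\<Sigma>(\<I>\<^sub>\<Lambda>)\<close>.\<close>

definition Tcoll :: "('k::real_field, 'l::ring_1, 'n::finite) integration_data \<Rightarrow>
    ('k \<times> 'k \<times> ('k, 'l) completed) set" where
  "Tcoll D = {(s, t, f). s \<in> II D \<and> t \<in> II D \<and> leI D s t \<and> f \<in> Shat_I D}"

definition pair_of :: "('k::real_field, 'l::ring_1, 'n::finite) integration_data \<Rightarrow>
    'k \<times> 'k \<times> ('k, 'l) completed \<Rightarrow> 'l set \<times> 'k" where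
  "pair_of D = (\<lambda>(s, t, f). (segL D s t, integral_over D s t f))"

definition plusT :: "('k::real_field, 'l::ring_1, 'n::finite) integration_data \<Rightarrow>
    'k \<times> 'k \<times> ('k, 'l) completed \<Rightarrow> 'k \<times> 'k \<times> ('k, 'l) completed \<Rightarrow> 'l set \<times> 'k" where
  "plusT D = (\<lambda>(u, v, f) (s, t, g).
     pair_of D (omin D {u, v, s, t}, omax D {u, v, s, t},
       compl_add D (cmin D) (dmax D)
         (compl_lift D (cmin D) (dmax D) (times_ind (segL D u v)) f)
         (compl_lift D (cmin D) (dmax D) (times_ind (segL D s t)) g)))"

definition Im_plus :: "('k::real_field, 'l::ring_1, 'n::finite) integration_data \<Rightarrow> ('l set \<times> 'k) set" where
  "Im_plus D = {plusT D x y | x y. x \<in> Tcoll D \<and> y \<in> Tcoll D}"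

text \<open>The addition carried by pairs: the common value of \<open>plusT\<close> on all elements of \<open>\<T>\<close> lying over
  the two pairs.\<close>

definition pair_add :: "('k::real_field, 'l::ring_1, 'n::finite) integration_data \<Rightarrow>
    'l set \<times> 'k \<Rightarrow> 'l set \<times> 'k \<Rightarrow> 'l set \<times> 'k" where
  "pair_add D P Q = (THE R. \<exists>x\<in>Tcoll D. \<exists>y\<in>Tcoll D. P = pair_of D x \<and> Q = pair_of D y \<and> R = plusT D x y)"

definition pair_scale :: "'k::real_field \<Rightarrow> 'l set \<times> 'k \<Rightarrow> 'l set \<times> 'k" where
  "pair_scale k = (\<lambda>(S, r). (S, k * r))"

definition pair_act :: "('k::real_field, 'l::ring_1, 'n::finite) integration_data \<Rightarrow>
    'l \<Rightarrow> 'l set \<times> 'k \<Rightarrow> 'l set \<times> 'k" where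
  "pair_act D a = (\<lambda>(S, r). (S, tau D a * r))"

text \<open>Elements of \<open>\<SS>\<close> are pairs \<open>(t, r)\<close> tagged with \<open>\<alpha>\<close>.\<close>

definition SS :: "('k::real_field, 'l::ring_1, 'n::finite) integration_data \<Rightarrow> ('k \<times> 'k \<times> 'k) set" where
  "SS D = (\<Union>\<alpha>\<in>II D. \<Union>f\<in>Shat_I D.
     {(\<alpha>, t, integral_over D \<alpha> t f) | t. t \<in> II D \<and> leI D \<alpha> t})"

definition Gmap :: "('k::real_field, 'l::ring_1, 'n::finite) integration_data \<Rightarrow>
    'k \<times> 'k \<times> 'k \<Rightarrow> 'l set \<times> 'k" where
  "Gmap D = (\<lambda>(\<alpha>, t, r). (segL D \<alpha> t, r))"

definition Im_G :: "('k::real_field, 'l::ring_1, 'n::finite) integration_data \<Rightarrow> ('l set \<times> 'k) set" where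
  "Im_G D = Gmap D ` SS D"

text \<open>
  The module structure in question has no global zero: adding \<open>([s,s], 0)\<close> to \<open>([u,v], r)\<close> enlarges
  the interval. All module identities not mentioning a zero hold. They give every \<open>x\<close> the local
  zero \<open>0 \<star> x\<close> (with \<open>0 \<star> x + x = x\<close>) and the local negative \<open>(-1) \<star> x\<close>
  (with \<open>x + (-1) \<star> x = 0 \<star> x\<close>), so a nonempty subset closed under the operations is a submodule
  in this sense.
\<close>

definition left_module_without_zero :: "('k \<Rightarrow> 'l::ring_1 \<Rightarrow> 'l) \<Rightarrow> 'e set \<Rightarrow> ('e \<Rightarrow> 'e \<Rightarrow> 'e) \<Rightarrow>
    ('k \<Rightarrow> 'e \<Rightarrow> 'e) \<Rightarrow> ('l \<Rightarrow> 'e \<Rightarrow> 'e) \<Rightarrow> bool" where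
  "left_module_without_zero sc M pl km act \<longleftrightarrow>
     (\<forall>x\<in>M. \<forall>y\<in>M. pl x y \<in> M \<and> pl x y = pl y x) \<and>
     (\<forall>x\<in>M. \<forall>y\<in>M. \<forall>z\<in>M. pl (pl x y) z = pl x (pl y z)) \<and>
     (\<forall>k. \<forall>x\<in>M. km k x \<in> M) \<and> (\<forall>a. \<forall>x\<in>M. act a x \<in> M) \<and>
     (\<forall>a. \<forall>x\<in>M. \<forall>y\<in>M. act a (pl x y) = pl (act a x) (act a y)) \<and>
     (\<forall>a b. \<forall>x\<in>M. act (a + b) x = pl (act a x) (act b x)) \<and>
     (\<forall>a b. \<forall>x\<in>M. act (a * b) x = act a (act b x)) \<and>
     (\<forall>x\<in>M. act 1 x = x) \<and>
     (\<forall>k a. \<forall>x\<in>M. act (sc k a) x = km k (act a x))"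

definition left_submodule :: "('k \<Rightarrow> 'l::ring_1 \<Rightarrow> 'l) \<Rightarrow> 'e set \<Rightarrow> 'e set \<Rightarrow> ('e \<Rightarrow> 'e \<Rightarrow> 'e) \<Rightarrow>
    ('k \<Rightarrow> 'e \<Rightarrow> 'e) \<Rightarrow> ('l \<Rightarrow> 'e \<Rightarrow> 'e) \<Rightarrow> bool" where
  "left_submodule sc N M pl km act \<longleftrightarrow> left_module_without_zero sc M pl km act \<and>
     N \<subseteq> M \<and> N \<noteq> {} \<and> (\<forall>x\<in>N. \<forall>y\<in>N. pl x y \<in> N) \<and>
     (\<forall>k. \<forall>x\<in>N. km k x \<in> N) \<and> (\<forall>a. \<forall>x\<in>N. act a x \<in> N)"

end

theory Submission
  imports Defs
begin

text \<open>
  Write \<open>R(s,t)\<close> for the set of integrals over \<open>[s,t]\<close> of the elements of the completion over the whole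
  segment (\<open>integral_values\<close>). The image of \<open>G\<close> consists of the pairs \<open>([s,t], r)\<close> with \<open>s \<preceq> t\<close> and
  \<open>r \<in> R(s,t)\<close>, and the main point is that the addition of such pairs is
  \<open>([u,v], r) + ([s,t], q) = ([y1,y2], r + q)\<close>,
  where \<open>[y1,y2]\<close> is the hull of the two intervals (\<open>pair_add_value\<close>). Then \<open>r + q \<in> R(y1,y2)\<close> holds by
  construction, the module laws are the laws of the field together with commutativity,
  associativity and idempotence of the hull, and the images of \<open>G\<close> and of the addition coincide, because
  \<open>([s,t], r)\<close> is its own sum with \<open>([s,t], 0)\<close>.

  The formula for the addition rests on two facts. The box over an interval determines its end points
  (\<open>segL_inj\<close>). And for \<open>[u,v]\<close> inside \<open>[s,t]\<close>, integrating \<open>f\<close> times the indicator of \<open>[u,v]\<close> over \<open>[s,t]\<close>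
  is the same as integrating \<open>f\<close> over \<open>[u,v]\<close> (\<open>integral_over_times_ind\<close>); with additivity of the integral
  this computes the second component of a sum from the integrals of the summands alone.

  The integrals over \<open>[s,t]\<close> and over \<open>[u,v]\<close> are given as morphisms out of two different completions, with
  no direct relation between them. For step functions both are the sum of coefficients times measures of
  boxes (\<open>That_step\<close>), which shows the equality there. A general element of a completion is the
  limit of the step functions that represent it, and morphisms are continuous, so that its integral
  is the limit of their integrals (\<open>That_limit\<close>), and the equality carries over.

  To calculate with representatives in the completions, the infimum of the norm expressions over all
  representations has to be a seminorm on step functions for which restriction to a smaller box is a
  contraction. Two representations have a common refinement; refining does not increase the norm
  expression, since \<open>\<Sum> a\<^sub>i\<^sup>p \<le> (\<Sum> a\<^sub>i)\<^sup>p\<close> for \<open>p \<ge> 1\<close>, and on the refinement the triangle inequality is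
  Minkowski's inequality.
\<close>

section \<open>Minkowski's inequality for finite sums\<close>

definition lp_norm :: "real \<Rightarrow> 'i set \<Rightarrow> ('i \<Rightarrow> real) \<Rightarrow> real" where
  "lp_norm p I a = (\<Sum>i\<in>I. a i powr p) powr (1 / p)"

text \<open>Convexity of \<open>x powr p\<close> on the closed half-line: the end point \<open>0\<close> is included
  because coefficients and measures of boxes may vanish.\<close>

lemma powr_convex_nonneg:
  fixes x y t p :: real
  assumes p: "1 \<le> p" and xy: "0 \<le> x" "0 \<le> y" and t: "0 \<le> t" "t \<le> 1"
  shows "((1 - t) * x + t * y) powr p \<le> (1 - t) * x powr p + t * y powr p"
proof -
  have shrink: "(r * z) powr p \<le> r * z powr p" if "0 \<le> r" "r \<le> 1" "0 \<le> z" for r z :: real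
  proof -
    have "r powr p \<le> r"
      using that p powr_mono'[of 1 p r] by simp
    then show ?thesis
      using that by (simp add: powr_mult mult_right_mono)
  qed
  consider "x = 0" | "y = 0" | "x > 0" "y > 0" using xy by fastforce
  then show ?thesis
  proof cases
    case 1 then show ?thesis using shrink[of t y] t xy p by simp
  next
    case 2 then show ?thesis using shrink[of "1 - t" x] t xy p by simp
  next
    case 3 then show ?thesis
      using convex_onD[OF powr_convex[OF p], of t x y] t by simp
  qed
qed

lemma lp_norm_nonneg: "0 \<le> lp_norm p I a"
  by (simp add: lp_norm_def)

lemma lp_norm_powr: "0 < p \<Longrightarrow> lp_norm p I a powr p = (\<Sum>i\<in>I. a i powr p)"
  by (simp add: lp_norm_def powr_powr sum_nonneg)

lemma lp_norm_le_iff: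
  assumes "0 < p" "0 \<le> c"
  shows "lp_norm p I a \<le> c \<longleftrightarrow> (\<Sum>i\<in>I. a i powr p) \<le> c powr p"
proof -
  have "lp_norm p I a \<le> c \<longleftrightarrow> lp_norm p I a powr p \<le> c powr p"
    using assms lp_norm_nonneg[of p I a] by (smt (verit) powr_less_mono2 powr_mono2)
  then show ?thesis using assms by (simp add: lp_norm_powr)
qed

lemma lp_norm_mono:
  assumes "0 < p" "\<And>i. i \<in> I \<Longrightarrow> 0 \<le> a i" "\<And>i. i \<in> I \<Longrightarrow> a i \<le> b i"
  shows "lp_norm p I a \<le> lp_norm p I b"
  unfolding lp_norm_le_iff[OF assms(1) lp_norm_nonneg] lp_norm_powr[OF assms(1)]
  using assms by (intro sum_mono powr_mono2) auto

lemma lp_norm_scale: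
  assumes "0 < p" "0 \<le> c" "\<And>i. i \<in> I \<Longrightarrow> 0 \<le> a i"
  shows "lp_norm p I (\<lambda>i. c * a i) = c * lp_norm p I a"
proof -
  have "(\<Sum>i\<in>I. (c * a i) powr p) = c powr p * (\<Sum>i\<in>I. a i powr p)"
    using assms by (simp add: powr_mult sum_distrib_left)
  then show ?thesis
    using assms by (simp add: lp_norm_def powr_mult sum_nonneg powr_powr)
qed

text \<open>Minkowski's inequality. After scaling \<open>a\<close> and \<open>b\<close> to norm \<open>1\<close>, their sum is a multiple of a convex
  combination, with weights proportional to the two norms, and convexity of \<open>x powr p\<close> applies to each
  summand.\<close>

lemma lp_norm_triangle:
  assumes fin: "finite I" and p: "1 \<le> p"
    and a: "\<And>i. i \<in> I \<Longrightarrow> 0 \<le> a i" and b: "\<And>i. i \<in> I \<Longrightarrow> 0 \<le> b i"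
  shows "lp_norm p I (\<lambda>i. a i + b i) \<le> lp_norm p I a + lp_norm p I b"
proof -
  have p0: "0 < p" using p by simp
  have vanish: "\<forall>i\<in>I. e i = 0"
    if z: "lp_norm p I e = 0" and e: "\<And>i. i \<in> I \<Longrightarrow> 0 \<le> e i" for e
  proof -
    have "(\<Sum>i\<in>I. e i powr p) = 0"
      using lp_norm_powr[OF p0, of I e] z by simp
    then show ?thesis by (simp add: sum_nonneg_eq_0_iff fin)
  qed
  consider "lp_norm p I a = 0" | "lp_norm p I b = 0" | "lp_norm p I a > 0" "lp_norm p I b > 0"
    using lp_norm_nonneg by (metis less_eq_real_def)
  then show ?thesis
  proof cases
    case 1
    then have "lp_norm p I (\<lambda>i. a i + b i) = lp_norm p I b"
      using vanish[OF 1 a] by (simp add: lp_norm_def)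
    then show ?thesis using 1 by simp
  next
    case 2
    then have "lp_norm p I (\<lambda>i. a i + b i) = lp_norm p I a"
      using vanish[OF 2 b] by (simp add: lp_norm_def)
    then show ?thesis using 2 by simp
  next
    case 3
    define A where "A = lp_norm p I a"
    define B where "B = lp_norm p I b"
    have AB: "0 < A" "0 < B" using 3 by (auto simp: A_def B_def)
    have sums: "(\<Sum>i\<in>I. a i powr p) = A powr p" "(\<Sum>i\<in>I. b i powr p) = B powr p"
      by (simp_all add: A_def B_def lp_norm_powr[OF p0])
    define t where "t = B / (A + B)"
    have t: "0 \<le> t" "t \<le> 1" "1 - t = A / (A + B)"
      using AB by (auto simp: t_def field_simps)
    have "(a i + b i) powr p \<le> (A + B) powr p * ((1 - t) * (a i / A) powr p + t * (b i / B) powr p)"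
      if "i \<in> I" for i
    proof -
      have "a i + b i = (A + B) * ((1 - t) * (a i / A) + t * (b i / B))"
      proof -
        have "(1 - t) * (a i / A) = a i / (A + B)" "t * (b i / B) = b i / (A + B)"
          unfolding t(3) using AB by (simp_all add: t_def)
        then show ?thesis using AB by (simp flip: add_divide_distrib)
      qed
      then have "(a i + b i) powr p = (A + B) powr p * ((1 - t) * (a i / A) + t * (b i / B)) powr p"
        using AB t a[OF that] b[OF that] by (simp add: powr_mult)
      then show ?thesis
        using powr_convex_nonneg[OF p, of "a i / A" "b i / B" t] AB t a[OF that] b[OF that]
        by (simp add: mult_left_mono)
    qed
    then have "(\<Sum>i\<in>I. (a i + b i) powr p)
        \<le> (\<Sum>i\<in>I. (A + B) powr p * ((1 - t) * (a i / A) powr p + t * (b i / B) powr p))"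
      by (rule sum_mono)
    also have "\<dots> = (A + B) powr p * ((1 - t) * (\<Sum>i\<in>I. (a i / A) powr p) + t * (\<Sum>i\<in>I. (b i / B) powr p))"
      by (simp add: sum.distrib flip: sum_distrib_left)
    also have "(\<Sum>i\<in>I. (a i / A) powr p) = 1"
      using AB a by (simp add: powr_divide sums flip: sum_divide_distrib)
    also have "(\<Sum>i\<in>I. (b i / B) powr p) = 1"
      using AB b by (simp add: powr_divide sums flip: sum_divide_distrib)
    finally show ?thesis
      using lp_norm_le_iff[OF p0, of "A + B" I] AB by (simp add: A_def B_def)
  qed
qed

text \<open>This is the reason why refining a partition can only lower the expression from which the norm of
  step functions is formed: the measures of the parts of a box add up to the measure of the box.\<close>

lemma sum_powr_le_powr_sum:
  fixes a :: "'i \<Rightarrow> real"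
  assumes "finite I" "1 \<le> p" "\<And>i. i \<in> I \<Longrightarrow> 0 \<le> a i"
  shows "(\<Sum>i\<in>I. a i powr p) \<le> (\<Sum>i\<in>I. a i) powr p"
proof (cases "(\<Sum>i\<in>I. a i) = 0")
  case True
  then show ?thesis using assms by (simp add: sum_nonneg_eq_0_iff)
next
  case False
  define S where "S = (\<Sum>i\<in>I. a i)"
  have S: "0 < S" using False sum_nonneg[of I a] assms by (simp add: S_def)
  have "a i powr p \<le> S powr p * (a i / S)" if "i \<in> I" for i
  proof -
    have "a i \<le> S" unfolding S_def using assms that by (intro member_le_sum) auto
    then have "(a i / S) powr p \<le> (a i / S) powr 1"
      using S assms that by (intro powr_mono') auto
    then show ?thesis using S assms that by (simp add: powr_divide field_simps)
  qed
  then have "(\<Sum>i\<in>I. a i powr p) \<le> (\<Sum>i\<in>I. S powr p * (a i / S))" by (rule sum_mono)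
  also have "\<dots> = S powr p"
    using S by (simp add: S_def flip: sum_distrib_left sum_divide_distrib)
  finally show ?thesis by (simp add: S_def)
qed


section \<open>The order on the segment and boxes\<close>

locale basic_integration_data =
  fixes D :: "('k::real_field, 'l::ring_1, 'n::finite) integration_data"
  assumes basic: "basic_setting D"
begin

lemma absv_nonneg [simp]: "0 \<le> absv D k"
  and absv_eq_0_iff [simp]: "absv D k = 0 \<longleftrightarrow> k = 0"
  and absv_mult: "absv D (k * l) = absv D k * absv D l"
  and absv_triangle: "absv D (k + l) \<le> absv D k + absv D l"
  and tau_add: "tau D (x + y) = tau D x + tau D y"
  and tau_mult: "tau D (x * y) = tau D x * tau D y"
  and tau_one [simp]: "tau D 1 = 1"
  and tau_scal: "tau D (scal D k x) = k * tau D x"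
  and pex_ge_1: "1 \<le> pex D"
  and linear_order: "linear_order_on (II D) (ordI D)"
  and cmin_in [simp]: "cmin D \<in> II D" and dmax_in [simp]: "dmax D \<in> II D"
  and vector_space: "finite_dimensional_vector_space (scal D) (range (bas D))"
  and inj_bas: "inj (bas D)"
  and finite_muI: "finite_measure (muI D)"
  and muI_point: "k \<in> II D \<Longrightarrow> emeasure (muI D) {k} = 0"
  and sets_mu: "sets (mu D) = SigmaL D"
  using basic unfolding basic_setting_def by auto

lemma cmin_le: "x \<in> II D \<Longrightarrow> leI D (cmin D) x" and le_dmax: "x \<in> II D \<Longrightarrow> leI D x (dmax D)"
  using basic unfolding basic_setting_def by auto

lemma emeasure_boxL:
  "(\<And>i. B i \<in> subintervals D) \<Longrightarrow> emeasure (mu D) (boxL D B) = (\<Prod>i\<in>UNIV. emeasure (muI D) (B i))"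
  using basic unfolding basic_setting_def by blast

lemma absv_one [simp]: "absv D 1 = 1"
  using absv_mult[of 1 1] by (simp add: absv_eq_0_iff[of 1, THEN iffD1])

lemma absv_zero [simp]: "absv D 0 = 0"
  by simp

lemma absv_minus [simp]: "absv D (- x) = absv D x"
proof -
  have "absv D (-1) * absv D (-1) = 1" using absv_mult[of "-1" "-1"] by simp
  then have "absv D (-1) = 1"
    using absv_nonneg[of "-1"] by (simp add: square_eq_1_iff)
  then show ?thesis using absv_mult[of "-1" x] by simp
qed

lemma absv_diff_triangle: "absv D (x - z) \<le> absv D (x - y) + absv D (y - z)"
  using absv_triangle[of "x - y" "y - z"] by simp

lemma pex_pos: "0 < pex D"
  using pex_ge_1 by simp

lemma leI_in: "leI D x y \<Longrightarrow> x \<in> II D" "leI D x y \<Longrightarrow> y \<in> II D"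
  using linear_order by (auto simp: leI_def order_on_defs)

lemma leI_refl: "x \<in> II D \<Longrightarrow> leI D x x"
  using linear_order by (auto simp: leI_def order_on_defs refl_on_def)

lemma leI_trans: "leI D x y \<Longrightarrow> leI D y z \<Longrightarrow> leI D x z"
  using linear_order by (auto simp: leI_def order_on_defs dest: transD)

lemma leI_antisym: "leI D x y \<Longrightarrow> leI D y x \<Longrightarrow> x = y"
  using linear_order by (auto simp: leI_def order_on_defs dest: antisymD)

lemma leI_total: "x \<in> II D \<Longrightarrow> y \<in> II D \<Longrightarrow> leI D x y \<or> leI D y x"
  using linear_order leI_refl by (cases "x = y") (auto simp: leI_def order_on_defs total_on_def)

lemma finite_has_omin:
  assumes "finite A" "A \<noteq> {}" "A \<subseteq> II D"
  shows "\<exists>x\<in>A. \<forall>y\<in>A. leI D x y"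
  using assms
proof (induction A rule: finite_ne_induct)
  case (singleton x) then show ?case by (simp add: leI_refl)
next
  case (insert x A)
  then obtain m where m: "m \<in> A" "\<forall>y\<in>A. leI D m y" by auto
  then have "leI D x m \<or> leI D m x" using insert.prems leI_total by auto
  then show ?case
  proof
    assume "leI D x m"
    then have "\<forall>y\<in>insert x A. leI D x y" using m insert.prems leI_refl leI_trans by blast
    then show ?thesis by blast
  next
    assume "leI D m x" then show ?thesis using m by blast
  qed
qed

lemma finite_has_omax:
  assumes "finite A" "A \<noteq> {}" "A \<subseteq> II D"
  shows "\<exists>x\<in>A. \<forall>y\<in>A. leI D y x"
  using assms
proof (induction A rule: finite_ne_induct)
  case (singleton x) then show ?case by (simp add: leI_refl)
next
  case (insert x A)
  then obtain m where m: "m \<in> A" "\<forall>y\<in>A. leI D y m" by auto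
  then have "leI D x m \<or> leI D m x" using insert.prems leI_total by auto
  then show ?case
  proof
    assume "leI D m x"
    then have "\<forall>y\<in>insert x A. leI D y x" using m insert.prems leI_refl leI_trans by blast
    then show ?thesis by blast
  next
    assume "leI D x m" then show ?thesis using m by blast
  qed
qed

lemma omin_eqI: "x \<in> A \<Longrightarrow> (\<And>y. y \<in> A \<Longrightarrow> leI D x y) \<Longrightarrow> omin D A = x"
  unfolding omin_def by (rule the_equality) (auto intro: leI_antisym)

lemma omax_eqI: "x \<in> A \<Longrightarrow> (\<And>y. y \<in> A \<Longrightarrow> leI D y x) \<Longrightarrow> omax D A = x"
  unfolding omax_def by (rule the_equality) (auto intro: leI_antisym)

lemma omin:
  assumes "finite A" "A \<noteq> {}" "A \<subseteq> II D"
  shows "omin D A \<in> A" "\<And>y. y \<in> A \<Longrightarrow> leI D (omin D A) y"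
proof -
  obtain x where x: "x \<in> A" "\<And>y. y \<in> A \<Longrightarrow> leI D x y" using finite_has_omin[OF assms] by blast
  note omin_eqI[OF x]
  then show "omin D A \<in> A" "\<And>y. y \<in> A \<Longrightarrow> leI D (omin D A) y" using x by auto
qed

lemma omax:
  assumes "finite A" "A \<noteq> {}" "A \<subseteq> II D"
  shows "omax D A \<in> A" "\<And>y. y \<in> A \<Longrightarrow> leI D y (omax D A)"
proof -
  obtain x where x: "x \<in> A" "\<And>y. y \<in> A \<Longrightarrow> leI D y x" using finite_has_omax[OF assms] by blast
  note omax_eqI[OF x]
  then show "omax D A \<in> A" "\<And>y. y \<in> A \<Longrightarrow> leI D y (omax D A)" using x by auto
qed

lemma seg_mono: "leI D s u \<Longrightarrow> leI D v t \<Longrightarrow> seg D u v \<subseteq> seg D s t"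
  using leI_trans by (auto simp: seg_def)

text \<open>The four kinds of subinterval are treated together by recording the set of removed end points.\<close>

lemma subintervals_iff:
  "S \<in> subintervals D \<longleftrightarrow> (\<exists>u v Z. u \<in> II D \<and> v \<in> II D \<and> Z \<subseteq> {u, v} \<and> S = seg D u v - Z)"
proof -
  have "(\<lambda>Z. seg D u v - Z) ` Pow {u, v} = {seg D u v, seg D u v - {u}, seg D u v - {v}, seg D u v - {u, v}}"
    for u v by (simp add: Pow_insert insert_commute)
  then have "subintervals D = (\<Union>u\<in>II D. \<Union>v\<in>II D. (\<lambda>Z. seg D u v - Z) ` Pow {u, v})"
    unfolding subintervals_def by (simp only:)
  then show ?thesis
    by (simp only: UN_iff image_iff Bex_def Pow_iff) metis
qed

lemma seg_diff_in_subintervals: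
  "u \<in> II D \<Longrightarrow> v \<in> II D \<Longrightarrow> Z \<subseteq> {u, v} \<Longrightarrow> seg D u v - Z \<in> subintervals D"
  unfolding subintervals_iff by blast

text \<open>With \<open>u\<close> the larger left and \<open>v\<close> the smaller right end point, the closed intervals meet in \<open>[u,v]\<close>
  (which is empty unless \<open>u \<preceq> v\<close>), and a removed end point that lies in \<open>[u,v]\<close> has to be \<open>u\<close> or \<open>v\<close>.\<close>

lemma subintervals_Int:
  assumes "A \<in> subintervals D" "B \<in> subintervals D"
  shows "A \<inter> B \<in> subintervals D"
proof -
  obtain a b Y where A: "A = seg D a b - Y" "a \<in> II D" "b \<in> II D" "Y \<subseteq> {a, b}"
    using assms(1) by (auto simp: subintervals_iff)
  obtain s t Z where B: "B = seg D s t - Z" "s \<in> II D" "t \<in> II D" "Z \<subseteq> {s, t}"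
    using assms(2) by (auto simp: subintervals_iff)
  define u where "u = omax D {a, s}"
  define v where "v = omin D {b, t}"
  have u: "u \<in> {a, s}" "leI D a u" "leI D s u"
    using omax[of "{a, s}"] A B by (auto simp: u_def)
  have v: "v \<in> {b, t}" "leI D v b" "leI D v t"
    using omin[of "{b, t}"] A B by (auto simp: v_def)
  have Int: "seg D a b \<inter> seg D s t = seg D u v"
  proof
    show "seg D a b \<inter> seg D s t \<subseteq> seg D u v" using u(1) v(1) by (auto simp: seg_def)
    show "seg D u v \<subseteq> seg D a b \<inter> seg D s t" using u v seg_mono by auto
  qed
  have "z \<in> {u, v}" if "z \<in> Y \<union> Z" "z \<in> seg D u v" for z
  proof -
    have "leI D u z" "leI D z v" using that by (auto simp: seg_def)
    moreover have "z = a \<or> z = b \<or> z = s \<or> z = t" using that A(4) B(4) by auto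
    ultimately show ?thesis using u v leI_antisym by auto
  qed
  then have "A \<inter> B = seg D u v - ((Y \<union> Z) \<inter> {u, v})"
    unfolding A(1) B(1) using Int by auto
  moreover have "u \<in> II D" "v \<in> II D" using u v leI_in by auto
  moreover have "(Y \<union> Z) \<inter> {u, v} \<subseteq> {u, v}" by (rule Int_lower2)
  ultimately show ?thesis using seg_diff_in_subintervals by simp
qed

lemma seg_in_subintervals: "u \<in> II D \<Longrightarrow> v \<in> II D \<Longrightarrow> seg D u v \<in> subintervals D"
  by (auto simp: subintervals_def)

lemma seg_split:
  assumes "leI D s u" "leI D u v" "leI D v t"
  shows "(seg D s u - {u}) \<union> seg D u v \<union> (seg D v t - {v}) = seg D s t"
    and "(seg D s u - {u}) \<inter> seg D u v = {}" "seg D u v \<inter> (seg D v t - {v}) = {}"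
    and "(seg D s u - {u}) \<inter> (seg D v t - {v}) = {}"
proof -
  show "(seg D s u - {u}) \<union> seg D u v \<union> (seg D v t - {v}) = seg D s t"
  proof (intro Set.set_eqI iffI)
    fix x assume "x \<in> (seg D s u - {u}) \<union> seg D u v \<union> (seg D v t - {v})"
    then show "x \<in> seg D s t"
      using seg_mono[of s s u t] seg_mono[of s u v t] seg_mono[of s v t t] assms
      by (auto dest: leI_trans intro: leI_refl leI_in)
  next
    fix x assume x: "x \<in> seg D s t"
    then have "x \<in> II D" by (simp add: seg_def)
    then have "leI D x u \<or> leI D u x" "leI D x v \<or> leI D v x"
      using leI_total leI_in assms by auto
    then show "x \<in> (seg D s u - {u}) \<union> seg D u v \<union> (seg D v t - {v})"
      using x assms leI_refl by (auto simp: seg_def)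
  qed
  show "(seg D s u - {u}) \<inter> seg D u v = {}" "seg D u v \<inter> (seg D v t - {v}) = {}"
    using leI_antisym by (auto simp: seg_def)
  show "(seg D s u - {u}) \<inter> (seg D v t - {v}) = {}"
  proof -
    have False if "leI D x u" "leI D v x" "x \<noteq> u" for x
      using leI_antisym[of x u] leI_trans[OF assms(2) that(2)] that by blast
    then show ?thesis by (auto simp: seg_def)
  qed
qed

lemma seg_inj:
  assumes "leI D s t" "leI D u v" "seg D s t = seg D u v"
  shows "s = u \<and> t = v"
proof -
  have "s \<in> seg D u v" "t \<in> seg D u v" "u \<in> seg D s t" "v \<in> seg D s t"
    using assms(1,2) assms(3)[symmetric] assms(3) leI_in leI_refl by (auto simp: seg_def)
  then show ?thesis using leI_antisym by (auto simp: seg_def)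
qed

text \<open>Linear independence of the basis. Boxes are therefore determined by their sides and intersect
  side by side.\<close>

lemma inj_comb: "inj (comb D)"
proof (rule injI)
  interpret finite_dimensional_vector_space "scal D" "range (bas D)" by (rule vector_space)
  fix x y assume eq: "comb D x = comb D y"
  show "x = y"
  proof
    fix i
    have "(\<Sum>b\<in>range (bas D). scal D (x (inv_into UNIV (bas D) b) - y (inv_into UNIV (bas D) b)) b) = comb D x - comb D y"
      by (simp add: sum.reindex[OF inj_bas] comb_def inj_bas scale_left_diff_distrib sum_subtractf)
    then have "x (inv_into UNIV (bas D) (bas D i)) - y (inv_into UNIV (bas D) (bas D i)) = 0"
      using independentD[OF independent_Basis finite_Basis subset_refl, of "\<lambda>b. x (inv_into UNIV (bas D) b) - y (inv_into UNIV (bas D) b)" "bas D i"] eq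
      by simp
    then show "x i = y i" by (simp add: inj_bas)
  qed
qed

lemma comb_eq_iff [simp]: "comb D x = comb D y \<longleftrightarrow> x = y"
  using inj_comb by (auto simp: inj_def)

lemma comb_in_boxL_iff [simp]: "comb D x \<in> boxL D B \<longleftrightarrow> (\<forall>i. x i \<in> B i)"
  by (auto simp: boxL_def)

lemma boxL_cases: "z \<in> boxL D B \<Longrightarrow> (\<And>x. z = comb D x \<Longrightarrow> (\<And>i. x i \<in> B i) \<Longrightarrow> thesis) \<Longrightarrow> thesis"
  by (auto simp: boxL_def)

lemma boxL_Int: "boxL D A \<inter> boxL D B = boxL D (\<lambda>i. A i \<inter> B i)"
  by (auto elim!: boxL_cases)

lemma boxes_Int: "X \<in> boxes D \<Longrightarrow> Y \<in> boxes D \<Longrightarrow> X \<inter> Y \<in> boxes D"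
  unfolding boxes_def mem_Collect_eq
proof (elim exE conjE)
  fix A B assume "X = boxL D A" "Y = boxL D B"
    and "\<forall>i. A i \<in> subintervals D" "\<forall>i. B i \<in> subintervals D"
  then show "\<exists>C. X \<inter> Y = boxL D C \<and> (\<forall>i. C i \<in> subintervals D)"
    by (intro exI[of _ "\<lambda>i. A i \<inter> B i"]) (simp add: boxL_Int subintervals_Int)
qed

lemma segL_in_boxes: "u \<in> II D \<Longrightarrow> v \<in> II D \<Longrightarrow> segL D u v \<in> boxes D"
  unfolding boxes_def segL_def using seg_in_subintervals by blast

lemma segL_mono: "leI D s u \<Longrightarrow> leI D v t \<Longrightarrow> segL D u v \<subseteq> segL D s t"
  unfolding segL_def using seg_mono[of s u v t] by (fastforce elim!: boxL_cases)

text \<open>A pair \<open>([s,t], r)\<close> remembers \<open>s\<close> and \<open>t\<close>; only the function that is integrated is lost. This is half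
  of the argument that the addition of pairs is well defined.\<close>

lemma segL_inj:
  assumes "leI D s t" "leI D u v" "segL D s t = segL D u v"
  shows "s = u \<and> t = v"
proof -
  have "x \<in> seg D a b \<longleftrightarrow> comb D (\<lambda>_. x) \<in> segL D a b" for x a b
    by (simp add: segL_def)
  then have "seg D s t = seg D u v" using assms(3) by blast
  then show ?thesis using seg_inj assms by blast
qed

lemma boxes_sets: "X \<in> boxes D \<Longrightarrow> X \<in> sets (mu D)"
  by (simp add: sets_mu SigmaL_def sigma_sets.Basic)

lemma boxes_finite:
  assumes "X \<in> boxes D" shows "emeasure (mu D) X \<noteq> \<infinity>"
proof -
  obtain B where B: "X = boxL D B" "\<And>i. B i \<in> subintervals D" using assms by (auto simp: boxes_def)
  have "(\<Prod>i\<in>UNIV. emeasure (muI D) (B i)) \<noteq> \<infinity>"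
    using finite_measure.emeasure_finite[OF finite_muI] by (simp add: ennreal_prod_eq_top)
  then show ?thesis using emeasure_boxL[OF B(2)] B(1) by simp
qed

lemma measure_box_mono:
  "X \<in> boxes D \<Longrightarrow> Y \<in> boxes D \<Longrightarrow> X \<subseteq> Y \<Longrightarrow> measure (mu D) X \<le> measure (mu D) Y"
  using boxes_finite[of Y] by (intro measure_mono_fmeasurable) (auto simp: fmeasurable_def boxes_sets top.not_eq_extremum)

lemma measure_box_Union:
  assumes "finite I" "disjoint_family_on X I" "\<And>i. i \<in> I \<Longrightarrow> X i \<in> boxes D" "(\<Union>i\<in>I. X i) \<in> boxes D"
  shows "measure (mu D) (\<Union>i\<in>I. X i) = (\<Sum>i\<in>I. measure (mu D) (X i))"
  using assms boxes_finite by (intro measure_finite_Union) (auto simp: boxes_sets)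

text \<open>The measure of a box is a product over a nonempty index type, so a single null side suffices.
  The lemma makes integration over \<open>[s,s]\<close>, which is \<open>0\<close> by convention, agree with the formula for step
  functions.\<close>

lemma measure_point_box:
  assumes "u \<in> II D" "X \<in> boxes D" "X \<subseteq> segL D u u"
  shows "measure (mu D) X = 0"
proof -
  have "seg D u u = {u}" using assms leI_refl leI_antisym by (auto simp: seg_def)
  then have "emeasure (mu D) (segL D u u) = 0"
    unfolding segL_def using emeasure_boxL[of "\<lambda>_. seg D u u"] muI_point[OF assms(1)]
      seg_in_subintervals[OF assms(1) assms(1)] by (simp add: zero_power)
  then have "measure (mu D) (segL D u u) = 0" by (simp add: measure_def)
  then show ?thesis
    using measure_box_mono[OF assms(2) segL_in_boxes[OF assms(1,1)] assms(3)] measure_nonneg[of "mu D" X]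
    by simp
qed

text \<open>Splitting each side \<open>[s,t]\<close> into \<open>[s,u)\<close>, \<open>[u,v]\<close> and \<open>(v,t]\<close> splits the box into \<open>3\<^sup>n\<close> boxes, one of them
  being the box of \<open>[u,v]\<close>. It follows that multiplication by the indicator of that box preserves step
  functions. Some of the boxes may be empty, hence a disjoint family and not a partition in the strict
  sense.\<close>

lemma box_partition_around:
  assumes "leI D s u" "leI D u v" "leI D v t"
  obtains J :: "('n \<Rightarrow> 'k set) set" and C where
    "finite J" "\<And>B. B \<in> J \<Longrightarrow> boxL D B \<in> boxes D" "disjoint_family_on (boxL D) J"
    "(\<Union>B\<in>J. boxL D B) = segL D s t" "C \<in> J" "boxL D C = segL D u v"
proof
  define K where "K = {seg D s u - {u}, seg D u v, seg D v t - {v}}"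
  define J where "J = {B :: 'n \<Rightarrow> 'k set. \<forall>i. B i \<in> K}"
  note split = seg_split[OF assms]
  have "J = (\<Pi>\<^sub>E i\<in>UNIV. K)" by (auto simp: J_def PiE_def Pi_def)
  moreover have "finite K" by (simp add: K_def)
  ultimately show "finite J" by (simp add: finite_PiE)
  have "K \<subseteq> subintervals D"
    using assms leI_in
    by (auto simp: K_def intro!: seg_in_subintervals seg_diff_in_subintervals)
  then show "boxL D B \<in> boxes D" if "B \<in> J" for B
    using that by (auto simp: boxes_def J_def)
  show "disjoint_family_on (boxL D) J"
    unfolding disjoint_family_on_def
  proof (intro ballI impI)
    fix A B assume AB: "A \<in> J" "B \<in> J" "A \<noteq> B"
    then obtain i where "A i \<noteq> B i" by (meson ext)
    moreover have "A i \<in> K" "B i \<in> K" using AB by (auto simp: J_def)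
    ultimately have "A i \<inter> B i = {}"
      using split(2-4) unfolding K_def by auto
    then show "boxL D A \<inter> boxL D B = {}" by (auto simp: boxL_Int elim!: boxL_cases)
  qed
  have cover: "x \<in> seg D s t \<longleftrightarrow> (\<exists>S\<in>K. x \<in> S)" for x
    unfolding split(1)[symmetric] K_def by simp
  show "(\<Union>B\<in>J. boxL D B) = segL D s t"
  proof
    show "(\<Union>B\<in>J. boxL D B) \<subseteq> segL D s t"
      by (auto simp: segL_def J_def cover elim!: boxL_cases) blast
    show "segL D s t \<subseteq> (\<Union>B\<in>J. boxL D B)"
    proof
      fix z assume "z \<in> segL D s t"
      then obtain x where x: "z = comb D x" "\<And>i. x i \<in> seg D s t"
        unfolding segL_def boxL_def by blast
      then have "\<forall>i. \<exists>S. S \<in> K \<and> x i \<in> S" using cover by blast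
      then obtain B where "\<And>i. B i \<in> K \<and> x i \<in> B i" by metis
      then show "z \<in> (\<Union>B\<in>J. boxL D B)" using x by (auto simp: J_def)
    qed
  qed
  show "(\<lambda>_. seg D u v) \<in> J" by (simp add: J_def K_def)
  show "boxL D (\<lambda>_. seg D u v) = segL D u v" by (simp add: segL_def)
qed


section \<open>Step functions and their seminorm\<close>

text \<open>A representation of a step function by an indexed family of boxes. In contrast to
  \<^const>\<open>step_rep\<close> the boxes may be empty, so that common refinements are simply indexed by products;
  and the function is described by its values and not by a sum, so that a new representation is
  checked pointwise.\<close>

definition box_values :: "'k \<Rightarrow> 'k \<Rightarrow> 'i set \<Rightarrow> ('i \<Rightarrow> 'l set) \<Rightarrow> ('i \<Rightarrow> 'k) \<Rightarrow> ('l \<Rightarrow> 'k) \<Rightarrow> bool" where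
  "box_values s t I X k f \<longleftrightarrow> finite I \<and> X ` I \<subseteq> boxes D \<and> disjoint_family_on X I \<and>
     (\<Union>i\<in>I. X i) = segL D s t \<and> (\<forall>i\<in>I. \<forall>x\<in>X i. f x = k i) \<and> (\<forall>x. x \<notin> segL D s t \<longrightarrow> f x = 0)"

definition box_norm :: "'i set \<Rightarrow> ('i \<Rightarrow> 'l set) \<Rightarrow> ('i \<Rightarrow> 'k) \<Rightarrow> real" where
  "box_norm I X k = lp_norm (pex D) I (\<lambda>i. absv D (k i) * measure (mu D) (X i))"

lemma step_rep_box_values:
  assumes "step_rep D s t P k f"
  shows "box_values s t P (\<lambda>X. X) k f"
proof -
  have P: "finite P" "P \<subseteq> boxes D" "partition_on (segL D s t) P" "f = (\<lambda>x. \<Sum>X\<in>P. k X * indicator X x)"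
    using assms by (auto simp: step_rep_def)
  have disj: "disjoint P" and Un: "\<Union>P = segL D s t" using P(3) by (auto simp: partition_on_def)
  have "f x = k X" if "X \<in> P" "x \<in> X" for X x
  proof -
    have "indicator Y x = (if Y = X then 1 else 0 :: 'k)" if "Y \<in> P" for Y
      using disj that \<open>X \<in> P\<close> \<open>x \<in> X\<close> by (auto simp: indicator_def disjoint_def)
    then have "f x = (\<Sum>Y\<in>P. if Y = X then k X else 0)"
      unfolding P(4) by (intro sum.cong) auto
    then show ?thesis using P(1) that by simp
  qed
  moreover have "f x = 0" if "x \<notin> segL D s t" for x
    unfolding P(4) using that Un by (intro sum.neutral) (auto simp: indicator_def)
  ultimately show ?thesis
    using P disj Un by (auto simp: box_values_def disjoint_family_on_def disjoint_def)
qed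

text \<open>Discarding the empty boxes makes the family injective, and empty boxes contribute \<open>0\<close> to the norm
  expression since \<open>0 powr p = 0\<close>.\<close>

lemma box_values_step_rep:
  assumes f: "box_values s t I X k f"
  obtains P l where "step_rep D s t P l f" "box_norm P (\<lambda>Y. Y) l = box_norm I X k"
proof
  define J where "J = {i \<in> I. X i \<noteq> {}}"
  define P where "P = X ` J"
  have fI: "finite I" "X ` I \<subseteq> boxes D" "disjoint_family_on X I" "(\<Union>i\<in>I. X i) = segL D s t"
    "\<And>i x. i \<in> I \<Longrightarrow> x \<in> X i \<Longrightarrow> f x = k i" "\<And>x. x \<notin> segL D s t \<Longrightarrow> f x = 0"
    using f by (auto simp: box_values_def)
  have inj: "inj_on X J"
    using fI(3) by (auto simp: inj_on_def J_def disjoint_family_on_def)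
  define l where "l = (\<lambda>Y. k (inv_into J X Y))"
  have l: "l (X i) = k i" if "i \<in> J" for i using inj that by (simp add: l_def)
  have "finite J" using fI(1) by (simp add: J_def)
  have Un: "\<Union>P = segL D s t" unfolding P_def J_def using fI(4) by blast
  have part: "partition_on (segL D s t) P"
  proof -
    have "X i \<inter> X j = {}" if "i \<in> J" "j \<in> J" "X i \<noteq> X j" for i j
      using that disjoint_family_onD[OF fI(3), of i j] by (cases "i = j") (auto simp: J_def)
    then have "disjoint P" by (auto simp: disjoint_def P_def)
    moreover have "{} \<notin> P" by (auto simp: P_def J_def)
    ultimately show ?thesis using Un by (simp add: partition_on_def)
  qed
  have "f x = (\<Sum>Y\<in>P. l Y * indicator Y x)" for x
  proof (cases "x \<in> segL D s t")
    case True
    then obtain i where i: "i \<in> J" "x \<in> X i" using fI(4) unfolding J_def by blast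
    have "indicator (X j) x = (if j = i then 1 else 0 :: 'k)" if "j \<in> J" for j
      using fI(3) that i by (auto simp: indicator_def disjoint_family_on_def J_def)
    then have "(\<Sum>j\<in>J. l (X j) * indicator (X j) x) = (\<Sum>j\<in>J. if j = i then k i else 0)"
      using l by (intro sum.cong) auto
    also have "\<dots> = f x" using i \<open>finite J\<close> fI(5)[of i x] by (simp add: J_def)
    finally show ?thesis by (simp add: P_def sum.reindex[OF inj])
  next
    case False
    have "(\<Sum>Y\<in>P. l Y * indicator Y x) = 0"
      using False Un by (intro sum.neutral) (auto simp: indicator_def)
    then show ?thesis using False fI(6) by simp
  qed
  then show "step_rep D s t P l f"
    using fI(1,2) part by (auto simp: step_rep_def P_def J_def)
  have "(\<Sum>Y\<in>P. (absv D (l Y) * measure (mu D) Y) powr pex D)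
      = (\<Sum>j\<in>J. (absv D (k j) * measure (mu D) (X j)) powr pex D)"
    unfolding P_def by (simp add: sum.reindex[OF inj] l)
  also have "\<dots> = (\<Sum>i\<in>I. (absv D (k i) * measure (mu D) (X i)) powr pex D)"
    using fI(1) by (intro sum.mono_neutral_left) (auto simp: J_def)
  finally show "box_norm P (\<lambda>Y. Y) l = box_norm I X k"
    by (simp add: box_norm_def lp_norm_def)
qed

lemma box_values_step: "box_values s t I X k f \<Longrightarrow> f \<in> step D s t"
  by (erule box_values_step_rep) (auto simp: step_def)

lemma box_norm_nonneg: "0 \<le> box_norm I X k"
  by (simp add: box_norm_def lp_norm_nonneg)

lemma step_norm_eq_Inf: "step_norm D s t f = Inf {box_norm P (\<lambda>Y. Y) k | P k. step_rep D s t P k f}"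
  unfolding step_norm_def box_norm_def lp_norm_def by (simp add: powr_mult)

lemma step_norm_le:
  assumes "box_values s t I X k f"
  shows "step_norm D s t f \<le> box_norm I X k"
proof -
  obtain P l where P: "step_rep D s t P l f" "box_norm P (\<lambda>Y. Y) l = box_norm I X k"
    using box_values_step_rep[OF assms] .
  have "step_norm D s t f \<le> box_norm P (\<lambda>Y. Y) l"
    unfolding step_norm_eq_Inf using P(1)
    by (intro cInf_lower bdd_belowI[of _ 0]) (auto simp: box_norm_nonneg)
  then show ?thesis using P by simp
qed

lemma step_norm_approx:
  assumes "f \<in> step D s t" "e > 0"
  obtains P k where "box_values s t P (\<lambda>X. X) k f" "box_norm P (\<lambda>X. X) k < step_norm D s t f + e"
proof -
  let ?S = "{box_norm P (\<lambda>Y. Y) k | P k. step_rep D s t P k f}"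
  have ne: "?S \<noteq> {}" using assms(1) by (auto simp: step_def)
  have "Inf ?S < step_norm D s t f + e" using assms(2) by (simp add: step_norm_eq_Inf)
  then obtain x where "x \<in> ?S" "x < step_norm D s t f + e"
    using cInf_lessD[OF ne] by blast
  then show ?thesis using that step_rep_box_values by blast
qed

lemma step_box_values:
  assumes "f \<in> step D s t"
  obtains P k where "box_values s t P (\<lambda>X. X) k f"
  using assms step_rep_box_values unfolding step_def by blast

lemma step_norm_nonneg:
  assumes "f \<in> step D s t" shows "0 \<le> step_norm D s t f"
proof -
  have "{box_norm P (\<lambda>Y. Y) k | P k. step_rep D s t P k f} \<noteq> {}" using assms by (auto simp: step_def)
  then show ?thesis
    unfolding step_norm_eq_Inf by (rule cInf_greatest) (auto simp: box_norm_nonneg)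
qed

lemma box_values_refine:
  assumes f: "box_values s t I X k f" and g: "box_values u v J Y l g"
    and sub: "segL D u v \<subseteq> segL D s t"
    and h: "\<And>i j x. i \<in> I \<Longrightarrow> j \<in> J \<Longrightarrow> x \<in> X i \<Longrightarrow> x \<in> Y j \<Longrightarrow> h x = m (i, j)"
    and h0: "\<And>x. x \<notin> segL D u v \<Longrightarrow> h x = 0"
  shows "box_values u v (I \<times> J) (\<lambda>(i, j). X i \<inter> Y j) m h"
  unfolding box_values_def
proof (intro conjI)
  show "finite (I \<times> J)" using f g by (auto simp: box_values_def)
  show "(\<lambda>(i, j). X i \<inter> Y j) ` (I \<times> J) \<subseteq> boxes D"
    using f g by (auto simp: box_values_def intro!: boxes_Int)
  show "disjoint_family_on (\<lambda>(i, j). X i \<inter> Y j) (I \<times> J)"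
  proof -
    have "disjoint_family_on X I" "disjoint_family_on Y J" using f g by (auto simp: box_values_def)
    then show ?thesis by (fastforce simp: disjoint_family_on_def)
  qed
  have "(\<Union>i\<in>I. X i) = segL D s t" "(\<Union>j\<in>J. Y j) = segL D u v"
    using f g by (auto simp: box_values_def)
  then show "(\<Union>p\<in>I \<times> J. case p of (i, j) \<Rightarrow> X i \<inter> Y j) = segL D u v" using sub by blast
  show "\<forall>p\<in>I \<times> J. \<forall>x\<in>case p of (i, j) \<Rightarrow> X i \<inter> Y j. h x = m p" using h by auto
  show "\<forall>x. x \<notin> segL D u v \<longrightarrow> h x = 0" using h0 by blast
qed

text \<open>Superadditivity of \<open>x powr p\<close>, applied inside each box \<open>X i\<close>.\<close>

lemma box_norm_refine:
  assumes fin: "finite I" "finite J" and X: "\<And>i. i \<in> I \<Longrightarrow> X i \<in> boxes D"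
    and Y: "\<And>j. j \<in> J \<Longrightarrow> Y j \<in> boxes D" "disjoint_family_on Y J" "(\<Union>j\<in>J. Y j) \<in> boxes D"
  shows "box_norm (I \<times> J) (\<lambda>(i, j). X i \<inter> Y j) (\<lambda>(i, j). k i) \<le> box_norm I X k"
proof -
  have "(\<Sum>(i, j)\<in>I \<times> J. (absv D (k i) * measure (mu D) (X i \<inter> Y j)) powr pex D)
      = (\<Sum>i\<in>I. \<Sum>j\<in>J. (absv D (k i) * measure (mu D) (X i \<inter> Y j)) powr pex D)"
    by (simp add: sum.cartesian_product)
  also have "\<dots> \<le> (\<Sum>i\<in>I. (absv D (k i) * measure (mu D) (X i)) powr pex D)"
  proof (rule sum_mono)
    fix i assume i: "i \<in> I"
    have Un: "(\<Union>j\<in>J. X i \<inter> Y j) = X i \<inter> (\<Union>j\<in>J. Y j)" by blast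
    have "(\<Sum>j\<in>J. measure (mu D) (X i \<inter> Y j)) = measure (mu D) (\<Union>j\<in>J. X i \<inter> Y j)"
      using Un Y(2) boxes_Int[OF X[OF i] Y(1)] boxes_Int[OF X[OF i] Y(3)] fin(2)
      by (intro measure_box_Union[symmetric]) (auto simp: disjoint_family_on_def)
    also have "\<dots> \<le> measure (mu D) (X i)"
      unfolding Un using X[OF i] Y(3) by (intro measure_box_mono boxes_Int) auto
    finally have le: "(\<Sum>j\<in>J. absv D (k i) * measure (mu D) (X i \<inter> Y j)) \<le> absv D (k i) * measure (mu D) (X i)"
      by (simp add: mult_left_mono flip: sum_distrib_left)
    have "(\<Sum>j\<in>J. (absv D (k i) * measure (mu D) (X i \<inter> Y j)) powr pex D)
        \<le> (\<Sum>j\<in>J. absv D (k i) * measure (mu D) (X i \<inter> Y j)) powr pex D"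
      using fin pex_ge_1 by (intro sum_powr_le_powr_sum) auto
    also have "\<dots> \<le> (absv D (k i) * measure (mu D) (X i)) powr pex D"
      using le pex_pos by (intro powr_mono2) (auto intro!: sum_nonneg)
    finally show "(\<Sum>j\<in>J. (absv D (k i) * measure (mu D) (X i \<inter> Y j)) powr pex D)
        \<le> (absv D (k i) * measure (mu D) (X i)) powr pex D" .
  qed
  also have "\<dots> = box_norm I X k powr pex D"
    unfolding box_norm_def by (simp add: lp_norm_powr[OF pex_pos])
  finally show ?thesis
    unfolding box_norm_def[of "I \<times> J"] lp_norm_le_iff[OF pex_pos box_norm_nonneg]
    by (simp add: case_prod_beta')
qed

lemma box_norm_swap:
  "box_norm (I \<times> J) (\<lambda>(i, j). X i \<inter> Y j) (\<lambda>(i, j). l j) = box_norm (J \<times> I) (\<lambda>(j, i). Y j \<inter> X i) (\<lambda>(j, i). l j)"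
proof -
  have "(\<Sum>p\<in>I \<times> J. g (fst p) (snd p)) = (\<Sum>p\<in>J \<times> I. g (snd p) (fst p))" for g :: "'a \<Rightarrow> 'b \<Rightarrow> real"
    using sum.swap[of g J I] by (simp add: sum.cartesian_product case_prod_beta')
  from this[of "\<lambda>i j. (absv D (l j) * measure (mu D) (X i \<inter> Y j)) powr pex D"] show ?thesis
    by (simp add: box_norm_def lp_norm_def case_prod_beta' Int_commute)
qed

text \<open>On the common refinement of the two representations Minkowski's inequality applies, and passing to
  that refinement does not increase either norm expression.\<close>

lemma step_add_bound:
  assumes st: "leI D s t" and f: "box_values s t I X k f" and g: "box_values s t J Y l g"
  shows "(\<lambda>x. f x + g x) \<in> step D s t"
    and "step_norm D s t (\<lambda>x. f x + g x) \<le> box_norm I X k + box_norm J Y l"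
proof -
  have box: "segL D s t \<in> boxes D" using st leI_in segL_in_boxes by blast
  have fI: "finite I" "\<And>i. i \<in> I \<Longrightarrow> X i \<in> boxes D" "disjoint_family_on X I" "(\<Union>i\<in>I. X i) \<in> boxes D"
    and gJ: "finite J" "\<And>j. j \<in> J \<Longrightarrow> Y j \<in> boxes D" "disjoint_family_on Y J" "(\<Union>j\<in>J. Y j) \<in> boxes D"
    using f g box by (auto simp: box_values_def)
  define Z where "Z = (\<lambda>(i, j). X i \<inter> Y j)"
  define m where "m = (\<lambda>(i, j). k i + l j)"
  have sum: "box_values s t (I \<times> J) Z m (\<lambda>x. f x + g x)"
    unfolding Z_def using f g
    by (intro box_values_refine[OF f g]) (auto simp: box_values_def m_def)
  then show "(\<lambda>x. f x + g x) \<in> step D s t" by (rule box_values_step)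
  have "step_norm D s t (\<lambda>x. f x + g x) \<le> box_norm (I \<times> J) Z m"
    by (rule step_norm_le[OF sum])
  also have "\<dots> \<le> lp_norm (pex D) (I \<times> J) (\<lambda>p. absv D (k (fst p)) * measure (mu D) (Z p)
      + absv D (l (snd p)) * measure (mu D) (Z p))"
    unfolding box_norm_def using absv_triangle
    by (intro lp_norm_mono[OF pex_pos]) (auto simp: m_def case_prod_beta' mult_right_mono simp flip: distrib_right)
  also have "\<dots> \<le> box_norm (I \<times> J) Z (\<lambda>(i, j). k i) + box_norm (I \<times> J) Z (\<lambda>(i, j). l j)"
    unfolding box_norm_def case_prod_beta' using fI gJ pex_ge_1 by (intro lp_norm_triangle) auto
  also have "\<dots> \<le> box_norm I X k + box_norm J Y l"
    unfolding Z_def box_norm_swap using fI gJ by (intro add_mono box_norm_refine) auto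
  finally show "step_norm D s t (\<lambda>x. f x + g x) \<le> box_norm I X k + box_norm J Y l" .
qed

lemma step_add:
  assumes "leI D s t" "f \<in> step D s t" "g \<in> step D s t"
  shows "(\<lambda>x. f x + g x) \<in> step D s t"
  using step_box_values[OF assms(2)] step_box_values[OF assms(3)] step_add_bound(1)[OF assms(1)] by metis

lemma step_norm_triangle:
  assumes "leI D s t" "f \<in> step D s t" "g \<in> step D s t"
  shows "step_norm D s t (\<lambda>x. f x + g x) \<le> step_norm D s t f + step_norm D s t g"
proof (rule field_le_epsilon)
  fix e :: real assume "e > 0"
  obtain P k where P: "box_values s t P (\<lambda>X. X) k f" "box_norm P (\<lambda>X. X) k < step_norm D s t f + e / 2"
    using step_norm_approx[OF assms(2), of "e / 2"] \<open>e > 0\<close> by auto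
  obtain Q l where Q: "box_values s t Q (\<lambda>X. X) l g" "box_norm Q (\<lambda>X. X) l < step_norm D s t g + e / 2"
    using step_norm_approx[OF assms(3), of "e / 2"] \<open>e > 0\<close> by auto
  show "step_norm D s t (\<lambda>x. f x + g x) \<le> step_norm D s t f + step_norm D s t g + e"
    using step_add_bound(2)[OF assms(1) P(1) Q(1)] P(2) Q(2) by simp
qed

lemma box_values_scale:
  "box_values s t I X k f \<Longrightarrow> box_values s t I X (\<lambda>i. r * k i) (\<lambda>x. r * f x)"
  by (auto simp: box_values_def)

lemma box_norm_scale: "box_norm I X (\<lambda>i. r * k i) = absv D r * box_norm I X k"
  unfolding box_norm_def absv_mult mult.assoc by (rule lp_norm_scale[OF pex_pos]) auto

lemma step_scale: "f \<in> step D s t \<Longrightarrow> (\<lambda>x. r * f x) \<in> step D s t"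
  by (erule step_box_values) (rule box_values_step, rule box_values_scale)

lemma step_norm_scale_le:
  assumes "f \<in> step D s t"
  shows "step_norm D s t (\<lambda>x. r * f x) \<le> absv D r * step_norm D s t f"
proof (rule field_le_epsilon)
  fix e :: real assume e: "e > 0"
  \<comment> \<open>The summand 1 keeps the denominator positive when \<open>r = 0\<close>.\<close>
  define d where "d = e / (1 + absv D r)"
  have "0 < 1 + absv D r" by (simp add: add_pos_nonneg)
  then have d: "d > 0" "absv D r * d \<le> e"
    using e by (simp_all add: d_def field_simps)
  obtain P k where P: "box_values s t P (\<lambda>X. X) k f" "box_norm P (\<lambda>X. X) k < step_norm D s t f + d"
    using step_norm_approx[OF assms d(1)] .
  have "step_norm D s t (\<lambda>x. r * f x) \<le> absv D r * box_norm P (\<lambda>X. X) k"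
    using step_norm_le[OF box_values_scale[OF P(1)], of r] by (simp add: box_norm_scale)
  also have "\<dots> \<le> absv D r * (step_norm D s t f + d)"
    using P(2) by (intro mult_left_mono) auto
  finally show "step_norm D s t (\<lambda>x. r * f x) \<le> absv D r * step_norm D s t f + e"
    using d(2) by (simp add: distrib_left)
qed

lemma box_values_zero:
  assumes "leI D s t" shows "box_values s t {()} (\<lambda>_. segL D s t) (\<lambda>_. 0) (\<lambda>_. 0)"
  using assms leI_in segL_in_boxes by (auto simp: box_values_def disjoint_family_on_def)

lemma step_zero: "leI D s t \<Longrightarrow> (\<lambda>_. 0) \<in> step D s t"
  using box_values_zero box_values_step by blast

lemma step_norm_zero: "leI D s t \<Longrightarrow> step_norm D s t (\<lambda>_. 0) = 0"
  using step_norm_scale_le[of "\<lambda>_. 0" s t 0] step_norm_nonneg[of "\<lambda>_. 0" s t] step_zero by simp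

lemma step_minus: "f \<in> step D s t \<Longrightarrow> (\<lambda>x. - f x) \<in> step D s t"
  using step_scale[of f s t "-1"] by simp

lemma step_norm_minus:
  assumes "f \<in> step D s t" shows "step_norm D s t (\<lambda>x. - f x) = step_norm D s t f"
  using step_norm_scale_le[OF assms, of "-1"] step_norm_scale_le[OF step_minus[OF assms], of "-1"] by simp

lemma step_diff:
  assumes "leI D s t" "f \<in> step D s t" "g \<in> step D s t"
  shows "(\<lambda>x. f x - g x) \<in> step D s t"
  using step_add[OF assms(1,2) step_minus[OF assms(3)]] by simp

lemma step_norm_diff_commute:
  assumes "leI D s t" "f \<in> step D s t" "g \<in> step D s t"
  shows "step_norm D s t (\<lambda>x. f x - g x) = step_norm D s t (\<lambda>x. g x - f x)"
  using step_norm_minus[OF step_diff[OF assms]] by simp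

lemma step_norm_diff_triangle:
  assumes "leI D s t" "f \<in> step D s t" "g \<in> step D s t" "h \<in> step D s t"
  shows "step_norm D s t (\<lambda>x. f x - h x) \<le> step_norm D s t (\<lambda>x. f x - g x) + step_norm D s t (\<lambda>x. g x - h x)"
  using step_norm_triangle[OF assms(1) step_diff[OF assms(1-3)] step_diff[OF assms(1,3,4)]] by simp

lemma step_norm_diff_bound:
  assumes "leI D s t" "f \<in> step D s t" "g \<in> step D s t"
  shows "\<bar>step_norm D s t f - step_norm D s t g\<bar> \<le> step_norm D s t (\<lambda>x. f x - g x)"
proof -
  have "step_norm D s t f \<le> step_norm D s t (\<lambda>x. f x - g x) + step_norm D s t g"
    using step_norm_triangle[OF assms(1) step_diff[OF assms] assms(3)] by simp
  moreover have "step_norm D s t g \<le> step_norm D s t (\<lambda>x. f x - g x) + step_norm D s t f"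
    using step_norm_triangle[OF assms(1) step_diff[OF assms(1,3,2)] assms(2)]
      step_norm_diff_commute[OF assms] by simp
  ultimately show ?thesis by linarith
qed

text \<open>The box of \<open>[u,v]\<close> is one of the boxes, with index \<open>C\<close>, of a partition of the box of \<open>[s,t]\<close>; refining the
  representation of \<open>f\<close> by that partition represents \<open>f\<close> times the indicator. With \<open>[u,v] = [s,t]\<close> this is
  restriction to \<open>[s,t]\<close>, and with \<open>[s,t] = [a,b]\<close> it is multiplication by an indicator on \<open>[a,b]\<close>.\<close>

lemma times_ind_box_values:
  assumes f: "box_values a b I X k f"
    and ord: "leI D a s" "leI D s u" "leI D u v" "leI D v t" "leI D t b"
  obtains J :: "('n \<Rightarrow> 'k set) set" and Y C where
    "box_values s t (I \<times> J) (\<lambda>(i, j). X i \<inter> Y j) (\<lambda>(i, j). if j = C then k i else 0)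
      (times_ind (segL D u v) f)"
    "finite J" "C \<in> J" "Y C = segL D u v"
proof -
  obtain J :: "('n \<Rightarrow> 'k set) set" and C where J: "finite J" "\<And>B. B \<in> J \<Longrightarrow> boxL D B \<in> boxes D"
    "disjoint_family_on (boxL D) J" "(\<Union>B\<in>J. boxL D B) = segL D s t" "C \<in> J" "boxL D C = segL D u v"
    using box_partition_around[OF ord(2-4)] by blast
  have unit: "box_values s t J (boxL D) (\<lambda>_. 1) (indicator (segL D s t))"
  proof -
    have "x \<in> segL D s t" if "j \<in> J" "x \<in> boxL D j" for j x using J(4) that by blast
    then show ?thesis using J by (auto simp: box_values_def)
  qed
  have "box_values s t (I \<times> J) (\<lambda>(i, j). X i \<inter> boxL D j) (\<lambda>(i, j). if j = C then k i else 0)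
      (times_ind (segL D u v) f)"
  proof (rule box_values_refine[OF f unit])
    show "segL D s t \<subseteq> segL D a b" using ord by (intro segL_mono)
    show "times_ind (segL D u v) f x = (case (i, j) of (i, j) \<Rightarrow> if j = C then k i else 0)"
      if "i \<in> I" "j \<in> J" "x \<in> X i" "x \<in> boxL D j" for i j x
    proof (cases "j = C")
      case True
      then show ?thesis using that f J(6) by (auto simp: times_ind_def box_values_def)
    next
      case False
      then have "x \<notin> segL D u v" using that J(3,5,6) by (auto simp: disjoint_family_on_def)
      then show ?thesis using False by (simp add: times_ind_def)
    qed
    show "times_ind (segL D u v) f x = 0" if "x \<notin> segL D s t" for x
      using that segL_mono[OF ord(2,4)] by (auto simp: times_ind_def indicator_def)
  qed
  then show ?thesis using that J by blast
qed

lemma sum_Times_single: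
  assumes "finite J" "C \<in> J" "\<And>i j. j \<noteq> C \<Longrightarrow> g (i, j) = 0"
  shows "(\<Sum>p\<in>I \<times> J. g p) = (\<Sum>i\<in>I. g (i, C))"
proof -
  have "(\<Sum>p\<in>I \<times> J. g p) = (\<Sum>i\<in>I. \<Sum>j\<in>J. g (i, j))"
    by (simp add: sum.cartesian_product)
  also have "\<dots> = (\<Sum>i\<in>I. \<Sum>j\<in>{C}. g (i, j))"
    using assms by (intro sum.cong refl sum.mono_neutral_right) auto
  finally show ?thesis by simp
qed

lemma times_ind_step:
  assumes "f \<in> step D a b" "leI D a s" "leI D s u" "leI D u v" "leI D v t" "leI D t b"
  shows "times_ind (segL D u v) f \<in> step D s t"
proof -
  obtain P k where "box_values a b P (\<lambda>X. X) k f" using step_box_values[OF assms(1)] .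
  then show ?thesis using times_ind_box_values[OF _ assms(2-6)] box_values_step by metis
qed

lemma step_norm_times_ind_le:
  assumes f: "f \<in> step D a b" and ord: "leI D a s" "leI D s u" "leI D u v" "leI D v t" "leI D t b"
  shows "step_norm D s t (times_ind (segL D u v) f) \<le> step_norm D a b f"
proof (rule field_le_epsilon)
  fix e :: real assume e: "e > 0"
  obtain P k where P: "box_values a b P (\<lambda>X. X) k f" "box_norm P (\<lambda>X. X) k < step_norm D a b f + e"
    using step_norm_approx[OF f e] .
  obtain J :: "('n \<Rightarrow> 'k set) set" and Y C where
    J: "box_values s t (P \<times> J) (\<lambda>(X, j). X \<inter> Y j) (\<lambda>(X, j). if j = C then k X else 0)
      (times_ind (segL D u v) f)" "finite J" "C \<in> J" "Y C = segL D u v"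
    using times_ind_box_values[OF P(1) ord] .
  have box: "X \<in> boxes D" if "X \<in> P" for X using P(1) that by (auto simp: box_values_def)
  have "box_norm (P \<times> J) (\<lambda>(X, j). X \<inter> Y j) (\<lambda>(X, j). if j = C then k X else 0)
      = lp_norm (pex D) P (\<lambda>X. absv D (k X) * measure (mu D) (X \<inter> segL D u v))"
    unfolding box_norm_def lp_norm_def using J(2-4) by (subst sum_Times_single[of J C]) auto
  also have "\<dots> \<le> box_norm P (\<lambda>X. X) k"
    unfolding box_norm_def using box leI_in ord
    by (intro lp_norm_mono[OF pex_pos] mult_left_mono measure_box_mono boxes_Int segL_in_boxes) auto
  finally show "step_norm D s t (times_ind (segL D u v) f) \<le> step_norm D a b f + e"
    using step_norm_le[OF J(1)] P(2) by simp
qed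


section \<open>The completion\<close>

lemma step_CauchyD: "F \<in> step_Cauchy D s t \<Longrightarrow> F i \<in> step D s t"
  by (simp add: step_Cauchy_def)

lemma const_step_Cauchy: "leI D s t \<Longrightarrow> f \<in> step D s t \<Longrightarrow> (\<lambda>_. f) \<in> step_Cauchy D s t"
  by (simp add: step_Cauchy_def step_norm_zero)

lemma equiv_compl_rel:
  assumes st: "leI D s t"
  shows "equiv (step_Cauchy D s t) (compl_rel D s t)"
proof (rule equivI)
  show "compl_rel D s t \<subseteq> step_Cauchy D s t \<times> step_Cauchy D s t"
    by (auto simp: compl_rel_def)
  show "refl_on (step_Cauchy D s t) (compl_rel D s t)"
    by (auto simp: refl_on_def compl_rel_def step_norm_zero[OF st])
  show "sym (compl_rel D s t)"
  proof (rule symI)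
    fix F G assume "(F, G) \<in> compl_rel D s t"
    then show "(G, F) \<in> compl_rel D s t"
      using step_norm_diff_commute[OF st step_CauchyD step_CauchyD] by (simp add: compl_rel_def)
  qed
  show "trans (compl_rel D s t)"
  proof (rule transI)
    fix F G H assume FG: "(F, G) \<in> compl_rel D s t" and GH: "(G, H) \<in> compl_rel D s t"
    then have C: "F \<in> step_Cauchy D s t" "G \<in> step_Cauchy D s t" "H \<in> step_Cauchy D s t"
      and lim: "(\<lambda>i. step_norm D s t (\<lambda>x. F i x - G i x) + step_norm D s t (\<lambda>x. G i x - H i x)) \<longlonglongrightarrow> 0"
      by (auto simp: compl_rel_def intro: tendsto_add_zero)
    have "(\<lambda>i. step_norm D s t (\<lambda>x. F i x - H i x)) \<longlonglongrightarrow> 0"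
    proof (rule tendsto_sandwich[OF _ _ tendsto_const lim])
      show "\<forall>\<^sub>F i in sequentially. 0 \<le> step_norm D s t (\<lambda>x. F i x - H i x)"
        using C step_CauchyD by (intro always_eventually allI step_norm_nonneg step_diff[OF st]) auto
      show "\<forall>\<^sub>F i in sequentially. step_norm D s t (\<lambda>x. F i x - H i x)
          \<le> step_norm D s t (\<lambda>x. F i x - G i x) + step_norm D s t (\<lambda>x. G i x - H i x)"
        using C step_CauchyD by (intro always_eventually allI step_norm_diff_triangle[OF st]) auto
    qed
    then show "(F, H) \<in> compl_rel D s t" using C by (simp add: compl_rel_def)
  qed
qed

abbreviation compl_class :: "'k \<Rightarrow> 'k \<Rightarrow> (nat \<Rightarrow> 'l \<Rightarrow> 'k) \<Rightarrow> ('k, 'l) completed" where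
  "compl_class s t F \<equiv> compl_rel D s t `` {F}"

lemma compl_class_in_Shat: "F \<in> step_Cauchy D s t \<Longrightarrow> compl_class s t F \<in> Shat D s t"
  by (simp add: Shat_def quotientI)

lemma Shat_cases:
  assumes "A \<in> Shat D s t"
  obtains F where "F \<in> step_Cauchy D s t" "A = compl_class s t F"
  using assms unfolding Shat_def by (rule quotientE)

text \<open>The operations on the completion are unions over all representatives; if every representative
  contributes the same set, any one of them computes the operation.\<close>

lemma UN_compl_class:
  assumes st: "leI D s t" and F: "F \<in> step_Cauchy D s t"
    and eq: "\<And>F'. (F, F') \<in> compl_rel D s t \<Longrightarrow> g F' = g F"
  shows "(\<Union>F'\<in>compl_class s t F. g F') = g F"
proof -
  have "F \<in> compl_class s t F" using equiv_class_self[OF equiv_compl_rel[OF st] F] .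
  then show ?thesis by (rule UN_constant_eq) (simp add: eq)
qed

text \<open>The Lipschitz condition is what makes a map of step functions, applied termwise, preserve Cauchy
  sequences and their equivalence, so that \<^const>\<open>compl_lift\<close> can be computed on any representative.\<close>

definition lipschitz_step_map :: "'k \<Rightarrow> 'k \<Rightarrow> 'k \<Rightarrow> 'k \<Rightarrow> (('l \<Rightarrow> 'k) \<Rightarrow> ('l \<Rightarrow> 'k)) \<Rightarrow> bool" where
  "lipschitz_step_map a b s t \<phi> \<longleftrightarrow> (\<forall>f\<in>step D a b. \<phi> f \<in> step D s t) \<and>
     (\<exists>L. \<forall>f\<in>step D a b. \<forall>g\<in>step D a b.
        step_norm D s t (\<lambda>x. \<phi> f x - \<phi> g x) \<le> L * step_norm D a b (\<lambda>x. f x - g x))"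

lemma lipschitz_step_Cauchy:
  assumes ab: "leI D a b" and \<phi>: "lipschitz_step_map a b s t \<phi>" and F: "F \<in> step_Cauchy D a b"
  shows "(\<lambda>i. \<phi> (F i)) \<in> step_Cauchy D s t"
proof -
  obtain L where L: "\<And>f g. f \<in> step D a b \<Longrightarrow> g \<in> step D a b \<Longrightarrow>
      step_norm D s t (\<lambda>x. \<phi> f x - \<phi> g x) \<le> L * step_norm D a b (\<lambda>x. f x - g x)"
    using \<phi> by (auto simp: lipschitz_step_map_def)
  have "\<exists>M. \<forall>i\<ge>M. \<forall>j\<ge>M. step_norm D s t (\<lambda>x. \<phi> (F i) x - \<phi> (F j) x) < e" if "e > 0" for e
  proof -
    have "e / (\<bar>L\<bar> + 1) > 0" using that by (simp add: add_nonneg_pos)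
    then obtain M where M: "\<And>i j. i \<ge> M \<Longrightarrow> j \<ge> M \<Longrightarrow> step_norm D a b (\<lambda>x. F i x - F j x) < e / (\<bar>L\<bar> + 1)"
      using F unfolding step_Cauchy_def by blast
    have "step_norm D s t (\<lambda>x. \<phi> (F i) x - \<phi> (F j) x) < e" if "i \<ge> M" "j \<ge> M" for i j
    proof -
      let ?n = "step_norm D a b (\<lambda>x. F i x - F j x)"
      have n: "0 \<le> ?n" using step_norm_nonneg step_diff[OF ab] step_CauchyD[OF F] by blast
      have "step_norm D s t (\<lambda>x. \<phi> (F i) x - \<phi> (F j) x) \<le> L * ?n"
        using L step_CauchyD[OF F] by blast
      also have "\<dots> \<le> (\<bar>L\<bar> + 1) * ?n" using n by (intro mult_right_mono) auto
      also have "\<dots> < e" using M[OF that] by (simp add: pos_less_divide_eq add_nonneg_pos mult.commute)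
      finally show ?thesis .
    qed
    then show ?thesis by blast
  qed
  then show ?thesis using \<phi> step_CauchyD[OF F] by (auto simp: step_Cauchy_def lipschitz_step_map_def)
qed

lemma lipschitz_compl_rel:
  assumes ab: "leI D a b" and st: "leI D s t" and \<phi>: "lipschitz_step_map a b s t \<phi>"
    and FG: "(F, G) \<in> compl_rel D a b"
  shows "((\<lambda>i. \<phi> (F i)), (\<lambda>i. \<phi> (G i))) \<in> compl_rel D s t"
proof -
  obtain L where L: "\<And>f g. f \<in> step D a b \<Longrightarrow> g \<in> step D a b \<Longrightarrow>
      step_norm D s t (\<lambda>x. \<phi> f x - \<phi> g x) \<le> L * step_norm D a b (\<lambda>x. f x - g x)"
    using \<phi> by (auto simp: lipschitz_step_map_def)
  have C: "F \<in> step_Cauchy D a b" "G \<in> step_Cauchy D a b"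
    and lim: "(\<lambda>i. step_norm D a b (\<lambda>x. F i x - G i x)) \<longlonglongrightarrow> 0"
    using FG by (auto simp: compl_rel_def)
  have C': "(\<lambda>i. \<phi> (F i)) \<in> step_Cauchy D s t" "(\<lambda>i. \<phi> (G i)) \<in> step_Cauchy D s t"
    using C lipschitz_step_Cauchy[OF ab \<phi>] by auto
  have "(\<lambda>i. step_norm D s t (\<lambda>x. \<phi> (F i) x - \<phi> (G i) x)) \<longlonglongrightarrow> 0"
  proof (rule tendsto_sandwich[OF _ _ tendsto_const])
    show "\<forall>\<^sub>F i in sequentially. 0 \<le> step_norm D s t (\<lambda>x. \<phi> (F i) x - \<phi> (G i) x)"
      using C' step_CauchyD by (auto intro!: always_eventually step_norm_nonneg step_diff[OF st])
    show "\<forall>\<^sub>F i in sequentially. step_norm D s t (\<lambda>x. \<phi> (F i) x - \<phi> (G i) x)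
        \<le> L * step_norm D a b (\<lambda>x. F i x - G i x)"
      using C step_CauchyD L by (auto intro!: always_eventually)
    show "(\<lambda>i. L * step_norm D a b (\<lambda>x. F i x - G i x)) \<longlonglongrightarrow> 0"
      using tendsto_mult_right_zero[OF lim] .
  qed
  then show ?thesis using C' by (simp add: compl_rel_def)
qed

lemma compl_lift_class:
  assumes ab: "leI D a b" and st: "leI D s t" and \<phi>: "lipschitz_step_map a b s t \<phi>"
    and F: "F \<in> step_Cauchy D a b"
  shows "compl_lift D s t \<phi> (compl_class a b F) = compl_class s t (\<lambda>i. \<phi> (F i))"
  unfolding compl_lift_def
proof (rule UN_compl_class[OF ab F])
  fix F' assume "(F, F') \<in> compl_rel D a b"
  from lipschitz_compl_rel[OF ab st \<phi> this]
  show "compl_class s t (\<lambda>i. \<phi> (F' i)) = compl_class s t (\<lambda>i. \<phi> (F i))"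
    by (rule equiv_class_eq[OF equiv_compl_rel[OF st], symmetric])
qed

lemma lipschitz_scale: "leI D s t \<Longrightarrow> lipschitz_step_map s t s t (\<lambda>f x. r * f x)"
  unfolding lipschitz_step_map_def
  using step_scale step_norm_scale_le[OF step_diff, of s t _ _ r]
  by (auto simp: right_diff_distrib intro!: exI[of _ "absv D r"])

lemma lipschitz_times_ind:
  assumes "leI D a s" "leI D s u" "leI D u v" "leI D v t" "leI D t b"
  shows "lipschitz_step_map a b s t (times_ind (segL D u v))"
proof -
  have ab: "leI D a b" using assms leI_trans by blast
  have "step_norm D s t (\<lambda>x. times_ind (segL D u v) f x - times_ind (segL D u v) g x)
      \<le> 1 * step_norm D a b (\<lambda>x. f x - g x)" if "f \<in> step D a b" "g \<in> step D a b" for f g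
    using step_norm_times_ind_le[OF step_diff[OF ab that] assms]
    by (simp add: times_ind_def right_diff_distrib)
  then show ?thesis
    unfolding lipschitz_step_map_def using times_ind_step[OF _ assms] by blast
qed

lemma step_Cauchy_add:
  assumes st: "leI D s t" and F: "F \<in> step_Cauchy D s t" and G: "G \<in> step_Cauchy D s t"
  shows "(\<lambda>i x. F i x + G i x) \<in> step_Cauchy D s t"
proof -
  have "\<exists>M. \<forall>i\<ge>M. \<forall>j\<ge>M. step_norm D s t (\<lambda>x. (F i x + G i x) - (F j x + G j x)) < e" if "e > 0" for e
  proof -
    have e: "e / 2 > 0" using that by simp
    obtain M where M: "\<And>i j. i \<ge> M \<Longrightarrow> j \<ge> M \<Longrightarrow> step_norm D s t (\<lambda>x. F i x - F j x) < e / 2"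
      using F e unfolding step_Cauchy_def by blast
    obtain N where N: "\<And>i j. i \<ge> N \<Longrightarrow> j \<ge> N \<Longrightarrow> step_norm D s t (\<lambda>x. G i x - G j x) < e / 2"
      using G e unfolding step_Cauchy_def by blast
    have "step_norm D s t (\<lambda>x. (F i x + G i x) - (F j x + G j x)) < e"
      if "i \<ge> max M N" "j \<ge> max M N" for i j
    proof -
      have "step_norm D s t (\<lambda>x. (F i x - F j x) + (G i x - G j x))
          \<le> step_norm D s t (\<lambda>x. F i x - F j x) + step_norm D s t (\<lambda>x. G i x - G j x)"
        using step_CauchyD[OF F] step_CauchyD[OF G] by (intro step_norm_triangle step_diff st)
      then show ?thesis using M[of i j] N[of i j] that by (simp add: algebra_simps)
    qed
    then show ?thesis by blast
  qed
  then show ?thesis using step_CauchyD[OF F] step_CauchyD[OF G] step_add[OF st] by (simp add: step_Cauchy_def)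
qed

lemma compl_rel_add:
  assumes st: "leI D s t" and F: "(F, F') \<in> compl_rel D s t" and G: "(G, G') \<in> compl_rel D s t"
  shows "((\<lambda>i x. F i x + G i x), (\<lambda>i x. F' i x + G' i x)) \<in> compl_rel D s t"
proof -
  have C: "F \<in> step_Cauchy D s t" "F' \<in> step_Cauchy D s t" "G \<in> step_Cauchy D s t" "G' \<in> step_Cauchy D s t"
    using F G by (auto simp: compl_rel_def)
  have st4: "F i \<in> step D s t" "F' i \<in> step D s t" "G i \<in> step D s t" "G' i \<in> step D s t" for i
    using C by (auto intro: step_CauchyD)
  have eq: "(F i x + G i x) - (F' i x + G' i x) = (F i x - F' i x) + (G i x - G' i x)" for i x
    by simp
  have "(\<lambda>i. step_norm D s t (\<lambda>x. (F i x + G i x) - (F' i x + G' i x))) \<longlonglongrightarrow> 0"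
    unfolding eq
  proof (rule tendsto_sandwich[OF _ _ tendsto_const])
    show "\<forall>\<^sub>F i in sequentially. 0 \<le> step_norm D s t (\<lambda>x. (F i x - F' i x) + (G i x - G' i x))"
      using st4 by (intro always_eventually allI step_norm_nonneg step_add step_diff st) auto
    show "\<forall>\<^sub>F i in sequentially. step_norm D s t (\<lambda>x. (F i x - F' i x) + (G i x - G' i x))
        \<le> step_norm D s t (\<lambda>x. F i x - F' i x) + step_norm D s t (\<lambda>x. G i x - G' i x)"
      using st4 by (intro always_eventually allI step_norm_triangle step_diff st) auto
    show "(\<lambda>i. step_norm D s t (\<lambda>x. F i x - F' i x) + step_norm D s t (\<lambda>x. G i x - G' i x)) \<longlonglongrightarrow> 0"
      using F G by (intro tendsto_add_zero) (auto simp: compl_rel_def)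
  qed
  then show ?thesis using C step_Cauchy_add[OF st] by (simp add: compl_rel_def)
qed

lemma compl_add_class:
  assumes st: "leI D s t" and F: "F \<in> step_Cauchy D s t" and G: "G \<in> step_Cauchy D s t"
  shows "compl_add D s t (compl_class s t F) (compl_class s t G) = compl_class s t (\<lambda>i x. F i x + G i x)"
proof -
  note eqv = equiv_compl_rel[OF st]
  have inner: "(\<Union>G'\<in>compl_class s t G. compl_class s t (\<lambda>i x. F' i x + G' i x))
      = compl_class s t (\<lambda>i x. F' i x + G i x)" if "F' \<in> step_Cauchy D s t" for F'
  proof (rule UN_compl_class[OF st G])
    fix G' assume "(G, G') \<in> compl_rel D s t"
    moreover have "(F', F') \<in> compl_rel D s t"
      using that by (simp add: compl_rel_def step_norm_zero[OF st])
    ultimately show "compl_class s t (\<lambda>i x. F' i x + G' i x) = compl_class s t (\<lambda>i x. F' i x + G i x)"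
      by (intro equiv_class_eq[OF eqv, symmetric] compl_rel_add[OF st])
  qed
  have "(\<Union>F'\<in>compl_class s t F. \<Union>G'\<in>compl_class s t G. compl_class s t (\<lambda>i x. F' i x + G' i x))
      = (\<Union>F'\<in>compl_class s t F. compl_class s t (\<lambda>i x. F' i x + G i x))"
    using inner by (intro SUP_cong refl) (auto simp: compl_rel_def)
  also have "\<dots> = compl_class s t (\<lambda>i x. F i x + G i x)"
  proof (rule UN_compl_class[OF st F])
    fix F' assume "(F, F') \<in> compl_rel D s t"
    moreover have "(G, G) \<in> compl_rel D s t"
      using G by (simp add: compl_rel_def step_norm_zero[OF st])
    ultimately show "compl_class s t (\<lambda>i x. F' i x + G i x) = compl_class s t (\<lambda>i x. F i x + G i x)"
      by (intro equiv_class_eq[OF eqv, symmetric] compl_rel_add[OF st])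
  qed
  finally show ?thesis by (simp add: compl_add_def)
qed

text \<open>The norms along a Cauchy sequence of step functions form a Cauchy sequence of reals, and equivalent
  sequences have the same limit of norms; so the description by \<open>THE\<close> has a value.\<close>

lemma compl_norm_class:
  assumes st: "leI D s t" and F: "F \<in> step_Cauchy D s t"
  shows "(\<lambda>i. step_norm D s t (F i)) \<longlonglongrightarrow> compl_norm D s t (compl_class s t F)"
proof -
  note diff = step_norm_diff_bound[OF st step_CauchyD step_CauchyD]
  have "Cauchy (\<lambda>i. step_norm D s t (F i))"
    unfolding Cauchy_def dist_real_def
  proof (intro allI impI)
    fix e :: real assume "e > 0"
    then obtain M where "\<And>i j. i \<ge> M \<Longrightarrow> j \<ge> M \<Longrightarrow> step_norm D s t (\<lambda>x. F i x - F j x) < e"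
      using F unfolding step_Cauchy_def by blast
    then show "\<exists>M. \<forall>m\<ge>M. \<forall>n\<ge>M. \<bar>step_norm D s t (F m) - step_norm D s t (F n)\<bar> < e"
      using diff[OF F F] by (meson le_less_trans)
  qed
  then obtain r where r: "(\<lambda>i. step_norm D s t (F i)) \<longlonglongrightarrow> r"
    by (auto simp: Cauchy_convergent_iff convergent_def)
  have all: "(\<lambda>i. step_norm D s t (G i)) \<longlonglongrightarrow> r" if "G \<in> compl_class s t F" for G
  proof -
    have G: "G \<in> step_Cauchy D s t" "(\<lambda>i. step_norm D s t (\<lambda>x. F i x - G i x)) \<longlonglongrightarrow> 0"
      using that by (auto simp: compl_rel_def)
    have "(\<lambda>i. step_norm D s t (F i) - step_norm D s t (G i)) \<longlonglongrightarrow> 0"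
      by (rule Lim_null_comparison[OF _ G(2)]) (simp add: diff[OF F G(1)])
    from tendsto_diff[OF r this] show ?thesis by simp
  qed
  have self: "F \<in> compl_class s t F" using equiv_class_self[OF equiv_compl_rel[OF st] F] .
  have "compl_norm D s t (compl_class s t F) = r"
    unfolding compl_norm_def
    by (rule the_equality) (use all LIMSEQ_unique[OF _ r] self in blast)+
  then show ?thesis using r by simp
qed

end


section \<open>The integral\<close>

locale interval_integration = basic_integration_data D
  for D :: "('k::real_field, 'l::ring_1, 'n::finite) integration_data" +
  assumes setting: "integration_setting D"
begin

lemma That_diag: "That D s s A = 0"
  by (simp add: That_def)

lemma That_morphism:
  assumes "leI D s t" "s \<noteq> t"
  shows "\<exists>\<theta>. A_morphism D s t (Shat_object D s t) (field_object D s t) \<theta> \<and> (\<forall>A. That D s t A = \<theta> A)"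
proof -
  have "\<exists>!\<theta>. A_morphism D s t (Shat_object D s t) (field_object D s t) \<theta>"
    using setting assms leI_in unfolding integration_setting_def ltI_def by blast
  from theI'[OF this] show ?thesis using assms(2) by (auto simp: That_def)
qed

lemma category_objects:
  assumes "leI D s t" "s \<noteq> t"
  shows "A_object D s t (Shat_object D s t)" "A_object D s t (field_object D s t)"
  using setting assms leI_in unfolding integration_setting_def ltI_def by blast+

lemma That_indicator:
  assumes "leI D s t" "s \<noteq> t" "X \<in> boxes D" "X \<subseteq> segL D s t"
  shows "That D s t (step_class D s t (indicator X)) = of_real (measure (mu D) X)"
  using setting assms leI_in unfolding integration_setting_def ltI_def by blast

lemma That_hom:
  assumes st: "leI D s t" and A: "A \<in> Shat D s t" and B: "B \<in> Shat D s t"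
  shows "That D s t (compl_add D s t A B) = That D s t A + That D s t B"
    and "That D s t (compl_lift D s t (\<lambda>f x. tau D a * f x) A) = tau D a * That D s t A"
proof -
  have "lambda_hom (Shat_module D s t) (field_module D) (That D s t)" if ne: "s \<noteq> t"
  proof -
    obtain \<theta> where "lambda_hom (Shat_module D s t) (field_module D) \<theta>" "\<forall>A. That D s t A = \<theta> A"
      using That_morphism[OF st ne] unfolding A_morphism_def Shat_object_def field_object_def by auto
    moreover from this(2) have "That D s t = \<theta>" by blast
    ultimately show ?thesis by simp
  qed
  then show "That D s t (compl_add D s t A B) = That D s t A + That D s t B"
    "That D s t (compl_lift D s t (\<lambda>f x. tau D a * f x) A) = tau D a * That D s t A"
    using A B by (cases "s = t"; simp add: That_diag lambda_hom_def Shat_module_def field_module_def)+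
qed

lemma That_add:
  assumes "leI D s t" "F \<in> step_Cauchy D s t" "G \<in> step_Cauchy D s t"
  shows "That D s t (compl_class s t (\<lambda>i x. F i x + G i x)) = That D s t (compl_class s t F) + That D s t (compl_class s t G)"
  using That_hom(1)[OF assms(1) assms(2,3)[THEN compl_class_in_Shat]] compl_add_class[OF assms] by simp

text \<open>Every scalar is the image of an element of the algebra, namely \<open>r = \<tau>(r 1)\<close>, so that the integral, being
  linear over the algebra, is linear over the field.\<close>

lemma That_scale:
  assumes "leI D s t" "F \<in> step_Cauchy D s t"
  shows "That D s t (compl_class s t (\<lambda>i x. r * F i x)) = r * That D s t (compl_class s t F)"
  using That_hom(2)[OF assms(1) assms(2,2)[THEN compl_class_in_Shat], of "scal D r 1"]
    compl_lift_class[OF assms(1,1) lipschitz_scale[OF assms(1), of r] assms(2)]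
  by (simp add: tau_scal)

text \<open>Each box of the family has a step function as its indicator, with the same family as
  representation; the value on indicators and linearity give the formula. For \<open>s = t\<close> both sides vanish
  because points are null sets.\<close>

lemma That_step:
  assumes st: "leI D s t" and f: "box_values s t I X k f"
  shows "That D s t (compl_class s t (\<lambda>_. f)) = (\<Sum>i\<in>I. k i * of_real (measure (mu D) (X i)))"
proof (cases "s = t")
  case True
  have "measure (mu D) (X i) = 0" if i: "i \<in> I" for i
  proof (rule measure_point_box)
    show "s \<in> II D" using st leI_in by blast
    show "X i \<in> boxes D" "X i \<subseteq> segL D s s"
      using f i True unfolding box_values_def by blast+
  qed
  then show ?thesis using True by (simp add: That_diag)
next
  case False
  have fI: "finite I" "\<And>i. i \<in> I \<Longrightarrow> X i \<in> boxes D" "disjoint_family_on X I" "(\<Union>i\<in>I. X i) = segL D s t"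
    "\<And>i x. i \<in> I \<Longrightarrow> x \<in> X i \<Longrightarrow> f x = k i" "\<And>x. x \<notin> segL D s t \<Longrightarrow> f x = 0"
    using f by (auto simp: box_values_def)
  have sub: "X i \<subseteq> segL D s t" if "i \<in> I" for i using fI(4) that by blast
  have ind: "indicator (X i) \<in> step D s t" if i: "i \<in> I" for i
  proof -
    have "indicator (X i) x = (if j = i then 1 else 0 :: 'k)" if "j \<in> I" "x \<in> X j" for j x
      using disjoint_family_onD[OF fI(3), of i j] i that by (auto simp: indicator_def)
    then have "box_values s t I X (\<lambda>j. if j = i then 1 else 0) (indicator (X i))"
      using fI sub[OF i] by (auto simp: box_values_def indicator_def)
    then show ?thesis by (rule box_values_step)
  qed
  have part: "(\<lambda>x. \<Sum>i\<in>K. k i * indicator (X i) x) \<in> step D s t \<and>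
      That D s t (compl_class s t (\<lambda>_ x. \<Sum>i\<in>K. k i * indicator (X i) x))
        = (\<Sum>i\<in>K. k i * of_real (measure (mu D) (X i)))" if "K \<subseteq> I" for K
    using finite_subset[OF that fI(1)] that
  proof (induction K rule: finite_induct)
    case empty
    show ?case
      using step_zero[OF st] That_scale[OF st const_step_Cauchy[OF st step_zero[OF st]], of 0] by simp
  next
    case (insert i K)
    let ?g = "\<lambda>x. \<Sum>j\<in>K. k j * indicator (X j) x" and ?h = "\<lambda>x. k i * indicator (X i) x"
    have i: "i \<in> I" and g: "?g \<in> step D s t" using insert by auto
    have h: "?h \<in> step D s t" using step_scale[OF ind[OF i]] .
    have "That D s t (compl_class s t (\<lambda>_. ?h)) = k i * of_real (measure (mu D) (X i))"
      using That_scale[OF st const_step_Cauchy[OF st ind[OF i]], of "k i"]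
        That_indicator[OF st False fI(2)[OF i] sub[OF i]] by (simp add: step_class_def)
    then have "That D s t (compl_class s t (\<lambda>_ x. ?h x + ?g x))
        = k i * of_real (measure (mu D) (X i)) + (\<Sum>j\<in>K. k j * of_real (measure (mu D) (X j)))"
      using That_add[OF st const_step_Cauchy[OF st h] const_step_Cauchy[OF st g]] insert by simp
    then show ?case
      unfolding sum.insert[OF insert.hyps] using step_add[OF st h g] by blast
  qed
  have "f x = (\<Sum>i\<in>I. k i * indicator (X i) x)" for x
  proof (cases "x \<in> segL D s t")
    case True
    then obtain i where i: "i \<in> I" "x \<in> X i" using fI(4) by blast
    have "indicator (X j) x = (if j = i then 1 else 0 :: 'k)" if "j \<in> I" for j
      using disjoint_family_onD[OF fI(3), of i j] i that by (auto simp: indicator_def)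
    then have "(\<Sum>j\<in>I. k j * indicator (X j) x) = (\<Sum>j\<in>I. if j = i then k i else 0)"
      by (intro sum.cong) auto
    then show ?thesis using i fI(1,5) by simp
  next
    case False
    have "(\<Sum>i\<in>I. k i * indicator (X i) x) = 0"
      using False sub by (intro sum.neutral) (auto simp: indicator_def)
    then show ?thesis using False fI(6) by simp
  qed
  then have "f = (\<lambda>x. \<Sum>i\<in>I. k i * indicator (X i) x)" by blast
  then show ?thesis using part[of I] by simp
qed

text \<open>A morphism is continuous, and the constant sequences at \<open>F i\<close> converge in the completion to the class of
  \<open>F\<close>: the norm of their difference is the limit over \<open>j\<close> of the norms of \<open>F i - F j\<close>. So the integral is
  determined by its values on step functions.\<close>

lemma That_limit:
  assumes st: "leI D s t" and F: "F \<in> step_Cauchy D s t"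
  shows "(\<lambda>i. absv D (That D s t (compl_class s t (\<lambda>_. F i)) - That D s t (compl_class s t F))) \<longlonglongrightarrow> 0"
proof (cases "s = t")
  case True then show ?thesis by (simp add: That_diag)
next
  case False
  let ?S = "Shat_module D s t"
  have S: "abelian_group ?S" and K: "abelian_group (field_module D)"
    using category_objects[OF st False] by (auto simp: A_object_def Shat_object_def field_object_def banach_module_def)
  have S_sel: "carrier ?S = Shat D s t" "zero ?S = compl_class s t (\<lambda>_ _. 0)"
    "add ?S = compl_add D s t" "mnorm ?S = compl_norm D s t"
    by (simp_all add: Shat_module_def step_class_def)
  have K_minus: "x \<ominus>\<^bsub>field_module D\<^esub> y = x - y" for x y
  proof -
    have "\<ominus>\<^bsub>field_module D\<^esub> y = - y"
      by (rule abelian_group.minus_equality[OF K]) (simp_all add: field_module_def)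
    then show ?thesis by (simp add: a_minus_def field_module_def)
  qed
  have const: "(\<lambda>_. F i) \<in> step_Cauchy D s t" for i
    using const_step_Cauchy[OF st step_CauchyD[OF F]] .
  have neg: "(\<lambda>j x. - F j x) \<in> step_Cauchy D s t"
    using lipschitz_step_Cauchy[OF st lipschitz_scale[OF st] F, of "-1"] by simp
  have diff: "(\<lambda>j x. F i x - F j x) \<in> step_Cauchy D s t" for i
    using step_Cauchy_add[OF st const neg, of i] by simp
  \<comment> \<open>The subtraction of the module is defined by a description; it is identified from uniqueness of inverses.\<close>
  have minus: "compl_class s t (\<lambda>_. F i) \<ominus>\<^bsub>?S\<^esub> compl_class s t F = compl_class s t (\<lambda>j x. F i x - F j x)" for i
  proof -
    have "\<ominus>\<^bsub>?S\<^esub> compl_class s t F = compl_class s t (\<lambda>j x. - F j x)"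
    proof (rule abelian_group.minus_equality[OF S])
      show "compl_class s t (\<lambda>j x. - F j x) \<oplus>\<^bsub>?S\<^esub> compl_class s t F = \<zero>\<^bsub>?S\<^esub>"
        unfolding S_sel compl_add_class[OF st neg F] by simp
    qed (simp_all add: S_sel compl_class_in_Shat F neg)
    then show ?thesis
      unfolding a_minus_def S_sel by (simp add: compl_add_class[OF st const neg])
  qed
  have "(\<lambda>i. compl_norm D s t (compl_class s t (\<lambda>j x. F i x - F j x))) \<longlonglongrightarrow> 0"
  proof (rule LIMSEQ_I)
    fix e :: real assume "e > 0"
    then have "e / 2 > 0" by simp
    then obtain M where M: "\<And>i j. i \<ge> M \<Longrightarrow> j \<ge> M \<Longrightarrow> step_norm D s t (\<lambda>x. F i x - F j x) < e / 2"
      using F unfolding step_Cauchy_def by blast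
    have "norm (compl_norm D s t (compl_class s t (\<lambda>j x. F i x - F j x)) - 0) < e" if "i \<ge> M" for i
    proof -
      note lim = compl_norm_class[OF st diff[of i]]
      have "compl_norm D s t (compl_class s t (\<lambda>j x. F i x - F j x)) \<le> e / 2"
        using M[OF that] by (intro LIMSEQ_le_const2[OF lim]) (auto intro: less_imp_le)
      moreover have "0 \<le> compl_norm D s t (compl_class s t (\<lambda>j x. F i x - F j x))"
        using step_norm_nonneg[OF step_CauchyD[OF diff[of i]]] by (intro LIMSEQ_le_const[OF lim]) auto
      ultimately show ?thesis using \<open>e > 0\<close> by simp
    qed
    then show "\<exists>M. \<forall>i\<ge>M. norm (compl_norm D s t (compl_class s t (\<lambda>j x. F i x - F j x)) - 0) < e"
      by blast
  qed
  then have conv: "converges_in ?S (\<lambda>i. compl_class s t (\<lambda>_. F i)) (compl_class s t F)"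
    by (simp add: converges_in_def minus S_sel compl_class_in_Shat const F)
  obtain \<theta> where "\<And>X x. converges_in ?S X x \<Longrightarrow> converges_in (field_module D) (\<lambda>i. \<theta> (X i)) (\<theta> x)"
    and \<theta>: "\<And>A. That D s t A = \<theta> A"
    using That_morphism[OF st False] unfolding A_morphism_def Shat_object_def field_object_def by auto
  from this(1)[OF conv] show ?thesis
    by (simp add: converges_in_def K_minus \<theta>) (simp add: field_module_def)
qed

lemma absv_limit_unique:
  assumes "(\<lambda>i. absv D (X i - x)) \<longlonglongrightarrow> 0" "(\<lambda>i. absv D (X i - y)) \<longlonglongrightarrow> 0"
  shows "x = y"
proof -
  have "(\<lambda>i. absv D (X i - x) + absv D (X i - y)) \<longlonglongrightarrow> 0"
    using tendsto_add[OF assms] by simp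
  moreover have "absv D (x - y) \<le> absv D (X i - x) + absv D (X i - y)" for i
    using absv_diff_triangle[of x y "X i"] absv_minus[of "X i - x"] by simp
  ultimately have "absv D (x - y) \<le> 0"
    by (intro LIMSEQ_le_const) auto
  then show ?thesis using absv_nonneg[of "x - y"] by (simp add: antisym_conv)
qed

text \<open>Both integrals are the sum of \<open>k X * \<mu>(X \<inter> [u,v])\<close> over the boxes \<open>X\<close> of a representation of \<open>f\<close>, an
  expression that does not involve \<open>s\<close> and \<open>t\<close>. This includes \<open>u = v\<close>.\<close>

lemma That_times_ind_step:
  assumes f: "f \<in> step D a b" and ord: "leI D a s" "leI D s u" "leI D u v" "leI D v t" "leI D t b"
  shows "That D s t (compl_class s t (\<lambda>_. times_ind (segL D u v) f))
    = That D u v (compl_class u v (\<lambda>_. times_ind (segL D u v) f))"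
proof -
  obtain P k where P: "box_values a b P (\<lambda>X. X) k f" using step_box_values[OF f] .
  have integral: "That D s t (compl_class s t (\<lambda>_. times_ind (segL D u v) f))
      = (\<Sum>X\<in>P. k X * of_real (measure (mu D) (X \<inter> segL D u v)))"
    if ord: "leI D a s" "leI D s u" "leI D u v" "leI D v t" "leI D t b" for s t
  proof -
    obtain J :: "('n \<Rightarrow> 'k set) set" and Y C where
      J: "box_values s t (P \<times> J) (\<lambda>(X, j). X \<inter> Y j) (\<lambda>(X, j). if j = C then k X else 0)
        (times_ind (segL D u v) f)" "finite J" "C \<in> J" "Y C = segL D u v"
      using times_ind_box_values[OF P ord] .
    have st: "leI D s t" using ord leI_trans by blast
    show ?thesis
      unfolding That_step[OF st J(1)] using J(2-4) by (subst sum_Times_single[of J C]) auto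
  qed
  have uv: "leI D a u" "leI D v b" "leI D u u" "leI D v v"
    using leI_trans[OF ord(1,2)] leI_trans[OF ord(4,5)] leI_refl leI_in[OF ord(3)] by blast+
  show ?thesis
    using integral[OF ord] integral[OF uv(1,3) ord(3) uv(4,2)] by simp
qed

text \<open>The two integrals are limits of integrals of step functions, which agree term by term.\<close>

lemma That_times_ind:
  assumes F: "F \<in> step_Cauchy D a b" and ord: "leI D a s" "leI D s u" "leI D u v" "leI D v t" "leI D t b"
  shows "That D s t (compl_class s t (\<lambda>i. times_ind (segL D u v) (F i)))
    = That D u v (compl_class u v (\<lambda>i. times_ind (segL D u v) (F i)))"
proof -
  have le: "leI D a b" "leI D s t" "leI D a u" "leI D v b" "leI D u u" "leI D v v"
    using leI_trans[OF ord(2) leI_trans[OF ord(3,4)]]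
      leI_trans[OF leI_trans[OF ord(1,2)] leI_trans[OF ord(3) leI_trans[OF ord(4,5)]]]
      leI_trans[OF ord(1,2)] leI_trans[OF ord(4,5)] leI_refl leI_in[OF ord(3)] by blast+
  have C: "(\<lambda>i. times_ind (segL D u v) (F i)) \<in> step_Cauchy D s t"
    "(\<lambda>i. times_ind (segL D u v) (F i)) \<in> step_Cauchy D u v"
    by (rule lipschitz_step_Cauchy[OF le(1) lipschitz_times_ind[OF ord] F],
        rule lipschitz_step_Cauchy[OF le(1) lipschitz_times_ind[OF le(3,5) ord(3) le(6,4)] F])
  show ?thesis
    using That_limit[OF le(2) C(1)] That_limit[OF ord(3) C(2)]
    unfolding That_times_ind_step[OF step_CauchyD[OF F] ord]
    by (rule absv_limit_unique)
qed

lemma cmin_le_dmax: "leI D (cmin D) (dmax D)"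
  by (simp add: cmin_le)

abbreviation whole_class :: "(nat \<Rightarrow> 'l \<Rightarrow> 'k) \<Rightarrow> ('k, 'l) completed" where
  "whole_class \<equiv> compl_class (cmin D) (dmax D)"

abbreviation whole_Cauchy :: "(nat \<Rightarrow> 'l \<Rightarrow> 'k) set" where
  "whole_Cauchy \<equiv> step_Cauchy D (cmin D) (dmax D)"

lemma whole_times_ind_Cauchy:
  assumes "F \<in> whole_Cauchy" "leI D s u" "leI D u v" "leI D v t"
  shows "(\<lambda>i. times_ind (segL D u v) (F i)) \<in> step_Cauchy D s t"
  using cmin_le le_dmax leI_in assms(2-4)
  by (intro lipschitz_step_Cauchy[OF cmin_le_dmax lipschitz_times_ind assms(1)]) auto

lemma compl_lift_times_ind_whole:
  assumes "F \<in> whole_Cauchy" "leI D s u" "leI D u v" "leI D v t"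
  shows "compl_lift D s t (times_ind (segL D u v)) (whole_class F) = compl_class s t (\<lambda>i. times_ind (segL D u v) (F i))"
proof (rule compl_lift_class[OF cmin_le_dmax _ _ assms(1)])
  show "leI D s t" using assms leI_trans by blast
  show "lipschitz_step_map (cmin D) (dmax D) s t (times_ind (segL D u v))"
    using assms cmin_le le_dmax leI_in by (intro lipschitz_times_ind) auto
qed

lemma integral_over_class:
  assumes "F \<in> whole_Cauchy" "leI D s t"
  shows "integral_over D s t (whole_class F) = That D s t (compl_class s t (\<lambda>i. times_ind (segL D s t) (F i)))"
  using compl_lift_times_ind_whole[OF assms(1), of s s t t] assms leI_refl leI_in
  by (simp add: integral_over_def restr_def)

lemma integral_over_add:
  assumes st: "leI D s t" and F: "F \<in> whole_Cauchy" and G: "G \<in> whole_Cauchy"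
  shows "integral_over D s t (whole_class (\<lambda>i x. F i x + G i x))
    = integral_over D s t (whole_class F) + integral_over D s t (whole_class G)"
proof -
  have le: "leI D s s" "leI D t t" using st leI_in leI_refl by auto
  have "times_ind (segL D s t) (\<lambda>x. F i x + G i x)
      = (\<lambda>x. times_ind (segL D s t) (F i) x + times_ind (segL D s t) (G i) x)" for i
    by (simp add: times_ind_def distrib_left)
  then show ?thesis
    using That_add[OF st whole_times_ind_Cauchy[OF F le(1) st le(2)] whole_times_ind_Cauchy[OF G le(1) st le(2)]]
    by (simp add: integral_over_class F G st step_Cauchy_add[OF cmin_le_dmax])
qed

lemma integral_over_scale:
  assumes st: "leI D s t" and F: "F \<in> whole_Cauchy"
  shows "integral_over D s t (whole_class (\<lambda>i x. r * F i x)) = r * integral_over D s t (whole_class F)"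
proof -
  have le: "leI D s s" "leI D t t" using st leI_in leI_refl by auto
  have "times_ind (segL D s t) (\<lambda>x. r * F i x) = (\<lambda>x. r * times_ind (segL D s t) (F i) x)" for i
    by (simp add: times_ind_def mult.left_commute)
  then show ?thesis
    using That_scale[OF st whole_times_ind_Cauchy[OF F le(1) st le(2)], of r]
      lipschitz_step_Cauchy[OF cmin_le_dmax lipschitz_scale[OF cmin_le_dmax] F, of r]
    by (simp add: integral_over_class F st)
qed

text \<open>A function that has been multiplied by the indicator of \<open>[u,v]\<close> is not changed by restriction to the
  larger interval, so its integral is the one compared in \<open>That_times_ind\<close>. Hence the second component of a sum of pairs does not depend on which functions
  represent the summands.\<close>

lemma integral_over_times_ind:
  assumes F: "F \<in> whole_Cauchy" and ord: "leI D s u" "leI D u v" "leI D v t"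
  shows "integral_over D s t (whole_class (\<lambda>i. times_ind (segL D u v) (F i))) = integral_over D u v (whole_class F)"
proof -
  have le: "leI D s t" "leI D (cmin D) s" "leI D t (dmax D)" "leI D (cmin D) u" "leI D v (dmax D)"
    using leI_trans[OF ord(1) leI_trans[OF ord(2,3)]] cmin_le le_dmax leI_in ord by auto
  have "times_ind (segL D s t) (times_ind (segL D u v) (F i)) = times_ind (segL D u v) (F i)" for i
    using segL_mono[OF ord(1,3)] by (auto simp: times_ind_def indicator_def fun_eq_iff)
  then have "integral_over D s t (whole_class (\<lambda>i. times_ind (segL D u v) (F i)))
      = That D s t (compl_class s t (\<lambda>i. times_ind (segL D u v) (F i)))"
    by (simp add: integral_over_class[OF whole_times_ind_Cauchy[OF F le(4) ord(2) le(5)] le(1)])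
  also have "\<dots> = That D u v (compl_class u v (\<lambda>i. times_ind (segL D u v) (F i)))"
    by (rule That_times_ind[OF F le(2) ord le(3)])
  finally show ?thesis by (simp add: integral_over_class F ord)
qed

section \<open>Addition of pairs\<close>

definition integral_values :: "'k \<Rightarrow> 'k \<Rightarrow> 'k set" where
  "integral_values s t = integral_over D s t ` Shat_I D"

lemma integral_values_cases:
  assumes "r \<in> integral_values s t"
  obtains F where "F \<in> whole_Cauchy" "r = integral_over D s t (whole_class F)"
  using assms by (auto simp: integral_values_def Shat_I_def elim: Shat_cases)

lemma integral_valuesI: "F \<in> whole_Cauchy \<Longrightarrow> integral_over D s t (whole_class F) \<in> integral_values s t"
  by (auto simp: integral_values_def Shat_I_def intro: compl_class_in_Shat)

lemma integral_values_scale: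
  assumes "leI D s t" "r \<in> integral_values s t"
  shows "k * r \<in> integral_values s t"
  using assms(2)
proof (rule integral_values_cases)
  fix F assume F: "F \<in> whole_Cauchy" "r = integral_over D s t (whole_class F)"
  then show ?thesis
    using integral_valuesI[OF lipschitz_step_Cauchy[OF cmin_le_dmax lipschitz_scale[OF cmin_le_dmax] F(1)], of s t k]
    by (simp add: integral_over_scale[OF assms(1)])
qed

definition hull_left :: "'k \<Rightarrow> 'k \<Rightarrow> 'k \<Rightarrow> 'k \<Rightarrow> 'k" where
  "hull_left u v s t = omin D {u, v, s, t}"

definition hull_right :: "'k \<Rightarrow> 'k \<Rightarrow> 'k \<Rightarrow> 'k \<Rightarrow> 'k" where
  "hull_right u v s t = omax D {u, v, s, t}"

lemma hull:
  assumes "leI D u v" "leI D s t"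
  shows "leI D (hull_left u v s t) u" "leI D v (hull_right u v s t)"
    "leI D (hull_left u v s t) s" "leI D t (hull_right u v s t)"
    "leI D (hull_left u v s t) (hull_right u v s t)"
proof -
  have "{u, v, s, t} \<subseteq> II D" using assms leI_in by auto
  from omin(2)[OF _ _ this] omax(2)[OF _ _ this]
  show h: "leI D (hull_left u v s t) u" "leI D v (hull_right u v s t)"
    "leI D (hull_left u v s t) s" "leI D t (hull_right u v s t)"
    by (auto simp: hull_left_def hull_right_def)
  show "leI D (hull_left u v s t) (hull_right u v s t)"
    using leI_trans[OF leI_trans[OF h(1) assms(1)] h(2)] .
qed

lemma plusT_value:
  assumes uv: "leI D u v" and st: "leI D s t" and f: "f \<in> Shat_I D" and g: "g \<in> Shat_I D"
  shows "plusT D (u, v, f) (s, t, g)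
      = (segL D (hull_left u v s t) (hull_right u v s t), integral_over D u v f + integral_over D s t g)"
    and "integral_over D u v f + integral_over D s t g \<in> integral_values (hull_left u v s t) (hull_right u v s t)"
proof -
  let ?l = "hull_left u v s t" and ?r = "hull_right u v s t"
  note h = hull[OF uv st]
  obtain F where F: "F \<in> whole_Cauchy" "f = whole_class F" using f Shat_cases unfolding Shat_I_def by blast
  obtain G where G: "G \<in> whole_Cauchy" "g = whole_class G" using g Shat_cases unfolding Shat_I_def by blast
  define F' where "F' = (\<lambda>i. times_ind (segL D u v) (F i))"
  define G' where "G' = (\<lambda>i. times_ind (segL D s t) (G i))"
  have le: "leI D (cmin D) u" "leI D v (dmax D)" "leI D (cmin D) s" "leI D t (dmax D)"
    using uv st leI_in cmin_le le_dmax by auto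
  have F': "F' \<in> whole_Cauchy" and G': "G' \<in> whole_Cauchy"
    unfolding F'_def G'_def using F G uv st le by (auto intro: whole_times_ind_Cauchy)
  have sum: "compl_add D (cmin D) (dmax D)
      (compl_lift D (cmin D) (dmax D) (times_ind (segL D u v)) f)
      (compl_lift D (cmin D) (dmax D) (times_ind (segL D s t)) g) = whole_class (\<lambda>i x. F' i x + G' i x)"
    using compl_lift_times_ind_whole[OF F(1) le(1) uv le(2)] compl_lift_times_ind_whole[OF G(1) le(3) st le(4)]
      compl_add_class[OF cmin_le_dmax F' G'] by (simp add: F G F'_def G'_def)
  have val: "integral_over D ?l ?r (whole_class (\<lambda>i x. F' i x + G' i x))
      = integral_over D u v f + integral_over D s t g"
    using integral_over_add[OF h(5) F' G'] integral_over_times_ind[OF F(1) h(1) uv h(2)]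
      integral_over_times_ind[OF G(1) h(3) st h(4)] by (simp add: F G F'_def G'_def)
  show "plusT D (u, v, f) (s, t, g) = (segL D ?l ?r, integral_over D u v f + integral_over D s t g)"
    unfolding plusT_def prod.case sum pair_of_def val[symmetric] by (simp add: hull_left_def hull_right_def)
  show "integral_over D u v f + integral_over D s t g \<in> integral_values ?l ?r"
    unfolding val[symmetric] using step_Cauchy_add[OF cmin_le_dmax F' G'] by (rule integral_valuesI)
qed

text \<open>The representing functions enter the sum only through the integrals, and the intervals are
  determined by the first components, so all elements of \<open>\<T>\<close> over the two pairs have the same sum.\<close>

lemma pair_add_value:
  assumes uv: "leI D u v" and r: "r \<in> integral_values u v" and st: "leI D s t" and q: "q \<in> integral_values s t"
  shows "pair_add D (segL D u v, r) (segL D s t, q)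
      = (segL D (hull_left u v s t) (hull_right u v s t), r + q)"
    and "r + q \<in> integral_values (hull_left u v s t) (hull_right u v s t)"
proof -
  obtain f where f: "f \<in> Shat_I D" "r = integral_over D u v f" using r by (auto simp: integral_values_def)
  obtain g where g: "g \<in> Shat_I D" "q = integral_over D s t g" using q by (auto simp: integral_values_def)
  show "r + q \<in> integral_values (hull_left u v s t) (hull_right u v s t)"
    using plusT_value(2)[OF uv st f(1) g(1)] f g by simp
  show "pair_add D (segL D u v, r) (segL D s t, q)
      = (segL D (hull_left u v s t) (hull_right u v s t), r + q)"
    unfolding pair_add_def
  proof (rule the_equality)
    have "(u, v, f) \<in> Tcoll D" "(s, t, g) \<in> Tcoll D"
      using uv st f g leI_in by (auto simp: Tcoll_def)
    then show "\<exists>x\<in>Tcoll D. \<exists>y\<in>Tcoll D. (segL D u v, r) = pair_of D x \<and> (segL D s t, q) = pair_of D y \<and>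
        (segL D (hull_left u v s t) (hull_right u v s t), r + q) = plusT D x y"
      using plusT_value(1)[OF uv st f(1) g(1)] f g
      by (intro bexI[of _ "(u, v, f)"] bexI[of _ "(s, t, g)"]) (auto simp: pair_of_def)
  next
    fix R assume "\<exists>x\<in>Tcoll D. \<exists>y\<in>Tcoll D. (segL D u v, r) = pair_of D x \<and> (segL D s t, q) = pair_of D y \<and>
        R = plusT D x y"
    then obtain u' v' f' s' t' g' where x: "(u', v', f') \<in> Tcoll D" "(segL D u v, r) = pair_of D (u', v', f')"
      and y: "(s', t', g') \<in> Tcoll D" "(segL D s t, q) = pair_of D (s', t', g')"
      and R: "R = plusT D (u', v', f') (s', t', g')"
      by (metis prod_cases3)
    have le: "leI D u' v'" "leI D s' t'" and fg: "f' \<in> Shat_I D" "g' \<in> Shat_I D"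
      using x y by (auto simp: Tcoll_def)
    have "u' = u" "v' = v" "s' = s" "t' = t"
      using segL_inj[OF uv le(1)] segL_inj[OF st le(2)] x(2) y(2) by (auto simp: pair_of_def)
    then show "R = (segL D (hull_left u v s t) (hull_right u v s t), r + q)"
      using R plusT_value(1)[OF le fg] x(2) y(2) by (auto simp: pair_of_def)
  qed
qed

lemma hull_commute: "hull_left u v s t = hull_left s t u v" "hull_right u v s t = hull_right s t u v"
  by (simp_all add: hull_left_def hull_right_def insert_commute)

lemma hull_self: "leI D u v \<Longrightarrow> hull_left u v u v = u \<and> hull_right u v u v = v"
  using leI_in leI_refl unfolding hull_left_def hull_right_def
  by (auto intro!: omin_eqI omax_eqI)

text \<open>An iterated hull is spanned by the extremes of all end points. This description is symmetric in the
  three intervals, and associativity of the hull follows.\<close>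

lemma hull_three:
  assumes "leI D u v" "leI D s t" "leI D w z"
  shows "hull_left (hull_left u v s t) (hull_right u v s t) w z = omin D {u, v, s, t, w, z}"
    and "hull_right (hull_left u v s t) (hull_right u v s t) w z = omax D {u, v, s, t, w, z}"
proof -
  let ?l = "hull_left u v s t" and ?r = "hull_right u v s t"
  have in1: "{u, v, s, t} \<subseteq> II D" using assms leI_in by auto
  have l: "?l \<in> {u, v, s, t}" "\<And>y. y \<in> {u, v, s, t} \<Longrightarrow> leI D ?l y"
    using omin[OF _ _ in1] by (auto simp: hull_left_def)
  have r: "?r \<in> {u, v, s, t}" "\<And>y. y \<in> {u, v, s, t} \<Longrightarrow> leI D y ?r"
    using omax[OF _ _ in1] by (auto simp: hull_right_def)
  have in2: "{?l, ?r, w, z} \<subseteq> II D" using l(1) r(1) in1 assms leI_in by auto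
  have L: "hull_left ?l ?r w z \<in> {?l, ?r, w, z}" "\<And>y. y \<in> {?l, ?r, w, z} \<Longrightarrow> leI D (hull_left ?l ?r w z) y"
    using omin[OF _ _ in2] by (auto simp: hull_left_def)
  have R: "hull_right ?l ?r w z \<in> {?l, ?r, w, z}" "\<And>y. y \<in> {?l, ?r, w, z} \<Longrightarrow> leI D y (hull_right ?l ?r w z)"
    using omax[OF _ _ in2] by (auto simp: hull_right_def)
  show "hull_left ?l ?r w z = omin D {u, v, s, t, w, z}"
  proof (rule omin_eqI[symmetric])
    show "hull_left ?l ?r w z \<in> {u, v, s, t, w, z}" using L(1) l(1) r(1) by auto
    show "leI D (hull_left ?l ?r w z) y" if "y \<in> {u, v, s, t, w, z}" for y
      using that L(2) leI_trans[OF L(2)[of ?l] l(2)[of y]] by auto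
  qed
  show "hull_right ?l ?r w z = omax D {u, v, s, t, w, z}"
  proof (rule omax_eqI[symmetric])
    show "hull_right ?l ?r w z \<in> {u, v, s, t, w, z}" using R(1) l(1) r(1) by auto
    show "leI D y (hull_right ?l ?r w z)" if "y \<in> {u, v, s, t, w, z}" for y
      using that R(2) leI_trans[OF r(2)[of y] R(2)[of ?r]] by auto
  qed
qed

lemma hull_assoc:
  assumes "leI D u v" "leI D s t" "leI D w z"
  shows "hull_left (hull_left u v s t) (hull_right u v s t) w z
      = hull_left u v (hull_left s t w z) (hull_right s t w z)"
    and "hull_right (hull_left u v s t) (hull_right u v s t) w z
      = hull_right u v (hull_left s t w z) (hull_right s t w z)"
proof -
  have eq: "{s, t, w, z, u, v} = {u, v, s, t, w, z}" by auto
  show "hull_left (hull_left u v s t) (hull_right u v s t) w z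
      = hull_left u v (hull_left s t w z) (hull_right s t w z)"
    unfolding hull_commute(1)[of u v "hull_left s t w z"] hull_three(1)[OF assms]
      hull_three(1)[OF assms(2,3,1)] eq ..
  show "hull_right (hull_left u v s t) (hull_right u v s t) w z
      = hull_right u v (hull_left s t w z) (hull_right s t w z)"
    unfolding hull_commute(2)[of u v "hull_left s t w z"] hull_three(2)[OF assms]
      hull_three(2)[OF assms(2,3,1)] eq ..
qed

lemma Im_G_eq: "Im_G D = {(segL D s t, r) | s t r. leI D s t \<and> r \<in> integral_values s t}"
proof (intro equalityI subsetI)
  fix p assume "p \<in> Im_G D"
  then obtain q where "q \<in> SS D" "p = Gmap D q" by (auto simp: Im_G_def)
  moreover from this(1) obtain s t f where "q = (s, t, integral_over D s t f)" "leI D s t" "f \<in> Shat_I D"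
    by (auto simp: SS_def)
  ultimately show "p \<in> {(segL D s t, r) | s t r. leI D s t \<and> r \<in> integral_values s t}"
    by (auto simp: Gmap_def integral_values_def)
next
  fix p assume "p \<in> {(segL D s t, r) | s t r. leI D s t \<and> r \<in> integral_values s t}"
  then obtain s t f where p: "p = (segL D s t, integral_over D s t f)" and st: "leI D s t" and f: "f \<in> Shat_I D"
    by (auto simp: integral_values_def)
  have "(s, t, integral_over D s t f) \<in> SS D"
    using st f leI_in by (auto simp: SS_def)
  then have "Gmap D (s, t, integral_over D s t f) \<in> Im_G D" unfolding Im_G_def by (rule imageI)
  then show "p \<in> Im_G D" by (simp add: p Gmap_def)
qed

lemma zero_in_integral_values: "leI D s t \<Longrightarrow> 0 \<in> integral_values s t"
  using integral_values_scale[of s t _ 0] integral_valuesI[OF const_step_Cauchy[OF cmin_le_dmax step_zero[OF cmin_le_dmax]]]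
  by force

text \<open>A sum of two elements is again a pair of an interval and an integral over it; conversely every
  such pair is its own sum with the pair of the same interval and \<open>0\<close>.\<close>

lemma Im_plus_eq: "Im_plus D = {(segL D s t, r) | s t r. leI D s t \<and> r \<in> integral_values s t}"
proof (intro equalityI subsetI)
  fix p assume "p \<in> Im_plus D"
  then obtain u v f s t g where "(u, v, f) \<in> Tcoll D" "(s, t, g) \<in> Tcoll D" "p = plusT D (u, v, f) (s, t, g)"
    unfolding Im_plus_def by (auto 0 3)
  then have uv: "leI D u v" and st: "leI D s t" and fg: "f \<in> Shat_I D" "g \<in> Shat_I D"
    and p: "p = plusT D (u, v, f) (s, t, g)" by (auto simp: Tcoll_def)
  show "p \<in> {(segL D s t, r) | s t r. leI D s t \<and> r \<in> integral_values s t}"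
    unfolding p plusT_value(1)[OF uv st fg] using plusT_value(2)[OF uv st fg] hull(5)[OF uv st] by blast
next
  fix p assume "p \<in> {(segL D s t, r) | s t r. leI D s t \<and> r \<in> integral_values s t}"
  then obtain s t f where p: "p = (segL D s t, integral_over D s t f)" and st: "leI D s t" and f: "f \<in> Shat_I D"
    by (auto simp: integral_values_def)
  obtain g where g: "g \<in> Shat_I D" "integral_over D s t g = 0"
    using zero_in_integral_values[OF st] by (auto simp: integral_values_def)
  have "p = plusT D (s, t, f) (s, t, g)"
    unfolding plusT_value(1)[OF st st f g(1)] p g(2) using hull_self[OF st] by simp
  moreover have "(s, t, f) \<in> Tcoll D" "(s, t, g) \<in> Tcoll D"
    using st f g leI_in by (auto simp: Tcoll_def)
  ultimately show "p \<in> Im_plus D" unfolding Im_plus_def by blast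
qed

text \<open>The addition is the formation of hulls in the first and addition of the field in the second
  component, and the actions change the second component only. In the law for \<open>(a + b) \<star> x\<close> the two
  summands lie over the same interval, which is its own hull.\<close>

lemma left_module_Im_plus:
  "left_module_without_zero (scal D) (Im_plus D) (pair_add D) pair_scale (pair_act D)"
proof -
  have ex: "\<exists>s t r. x = (segL D s t, r) \<and> leI D s t \<and> r \<in> integral_values s t" if "x \<in> Im_plus D" for x
    using that unfolding Im_plus_eq by blast
  have mem: "(segL D s t, r) \<in> Im_plus D" if "leI D s t" "r \<in> integral_values s t" for s t r
    using that unfolding Im_plus_eq by blast
  have add: "pair_add D x y \<in> Im_plus D \<and> pair_add D x y = pair_add D y x"
    if xy: "x \<in> Im_plus D" "y \<in> Im_plus D" for x y
  proof -
    obtain u v r s t q where x: "x = (segL D u v, r)" "leI D u v" "r \<in> integral_values u v"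
      and y: "y = (segL D s t, q)" "leI D s t" "q \<in> integral_values s t" using ex[OF xy(1)] ex[OF xy(2)] by blast
    show ?thesis
      unfolding x(1) y(1) pair_add_value(1)[OF x(2,3) y(2,3)] pair_add_value(1)[OF y(2,3) x(2,3)]
      using mem[OF hull(5)[OF x(2) y(2)] pair_add_value(2)[OF x(2,3) y(2,3)]] hull_commute[of u v s t]
      by (simp add: add.commute)
  qed
  have assoc: "pair_add D (pair_add D x y) z = pair_add D x (pair_add D y z)"
    if xyz: "x \<in> Im_plus D" "y \<in> Im_plus D" "z \<in> Im_plus D" for x y z
  proof -
    obtain u v r s t q w e m where x: "x = (segL D u v, r)" "leI D u v" "r \<in> integral_values u v"
      and y: "y = (segL D s t, q)" "leI D s t" "q \<in> integral_values s t"
      and z: "z = (segL D w e, m)" "leI D w e" "m \<in> integral_values w e"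
      using ex[OF xyz(1)] ex[OF xyz(2)] ex[OF xyz(3)] by blast
    show ?thesis
      unfolding x(1) y(1) z(1) pair_add_value(1)[OF x(2,3) y(2,3)] pair_add_value(1)[OF y(2,3) z(2,3)]
        pair_add_value(1)[OF hull(5)[OF x(2) y(2)] pair_add_value(2)[OF x(2,3) y(2,3)] z(2,3)]
        pair_add_value(1)[OF x(2,3) hull(5)[OF y(2) z(2)] pair_add_value(2)[OF y(2,3) z(2,3)]]
        hull_assoc[OF x(2) y(2) z(2)] by (simp add: add.assoc)
  qed
  have act: "pair_act D a x \<in> Im_plus D" and scale: "pair_scale k x \<in> Im_plus D"
    if "x \<in> Im_plus D" for a k x
    using ex[OF that] mem integral_values_scale by (auto simp: pair_act_def pair_scale_def)
  have act_pair: "pair_act D a (S, r) = (S, tau D a * r)" for a S r by (simp add: pair_act_def)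
  have act_add: "pair_act D a (pair_add D x y) = pair_add D (pair_act D a x) (pair_act D a y)"
    if xy: "x \<in> Im_plus D" "y \<in> Im_plus D" for a x y
  proof -
    obtain u v r s t q where x: "x = (segL D u v, r)" "leI D u v" "r \<in> integral_values u v"
      and y: "y = (segL D s t, q)" "leI D s t" "q \<in> integral_values s t" using ex[OF xy(1)] ex[OF xy(2)] by blast
    show ?thesis
      unfolding x(1) y(1) act_pair pair_add_value(1)[OF x(2,3) y(2,3)]
        pair_add_value(1)[OF x(2) integral_values_scale[OF x(2,3)] y(2) integral_values_scale[OF y(2,3)]]
      by (simp add: distrib_left)
  qed
  have add_act: "pair_act D (a + b) x = pair_add D (pair_act D a x) (pair_act D b x)"
    if x0: "x \<in> Im_plus D" for a b x
  proof -
    obtain u v r where x: "x = (segL D u v, r)" "leI D u v" "r \<in> integral_values u v" using ex[OF x0] by blast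
    show ?thesis
      unfolding x(1) act_pair
        pair_add_value(1)[OF x(2) integral_values_scale[OF x(2,3)] x(2) integral_values_scale[OF x(2,3)]]
      using hull_self[OF x(2)] by (simp add: tau_add distrib_right)
  qed
  have "pair_act D (a * b) x = pair_act D a (pair_act D b x)" "pair_act D 1 x = x"
    "pair_act D (scal D k a) x = pair_scale k (pair_act D a x)" for a b k x
    by (auto simp: pair_act_def pair_scale_def tau_mult tau_scal mult.assoc split: prod.splits)
  then show ?thesis
    unfolding left_module_without_zero_def using add assoc act scale act_add add_act by simp
qed

end

theorem proposition3p13:
  fixes D :: "('k::real_field, 'l::ring_1, 'n::finite) integration_data"
  assumes "integration_setting D"
  shows "Im_G D = {(segL D \<alpha> t, That D \<alpha> t (restr D \<alpha> t f)) | \<alpha> t f.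
           \<alpha> \<in> II D \<and> t \<in> II D \<and> leI D \<alpha> t \<and> f \<in> Shat_I D}
       \<and> left_submodule (scal D) (Im_G D) (Im_plus D) (pair_add D) pair_scale (pair_act D)"
proof -
  interpret interval_integration D
    using assms by unfold_locales (auto simp: integration_setting_def)
  have "Im_G D = {(segL D \<alpha> t, That D \<alpha> t (restr D \<alpha> t f)) | \<alpha> t f.
      \<alpha> \<in> II D \<and> t \<in> II D \<and> leI D \<alpha> t \<and> f \<in> Shat_I D}"
    using leI_in unfolding Im_G_eq integral_values_def integral_over_def by blast
  moreover have "Im_G D = Im_plus D" unfolding Im_G_eq Im_plus_eq ..
  moreover have "Im_plus D \<noteq> {}"
    using zero_in_integral_values[OF cmin_le_dmax] cmin_le_dmax unfolding Im_plus_eq by blast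
  ultimately show ?thesis
    using left_module_Im_plus unfolding left_submodule_def left_module_without_zero_def by simp
qed

end
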